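(* Let $t_1,\dots,t_m$ be i.i.d. random variables, each uniformly distributed over $[0,1)$. Let $A\in\mathbb{C}^{m\times N}$ be the matrix with entries $A_{l,k}=e^{2\pi \mathrm{i}kt_l}$, $l=1,\dots,m$, $k\in\Gamma=\{-q,\dots,q\}$, $N=2q+1$, let $r=\operatorname{rank}(A)$, and let $\sigma_r(A)$ be the smallest nonzero singular value of $A$. Then $$\mathbb{E}\left[\frac{1}{\sigma_r^2(A)}\right]=+\infty.$$ Furthermore, the expected reconstruction risk diverges, i.e. $\mathbb{E}[\|\hat{x}-x\|^2]=+\infty$, where $y=Ax+e$ and $\hat{x}=A^\dagger y$.
   Context: Observation model: $y=Ax+e$, where $x\in\mathbb{C}^N$ is a random vector with $\mathbb{E}[xx^*]=I_N$, and $e\in\mathbb{C}^m$ is noise with $\operatorname{Re}(e),\operatorname{Im}(e)\sim\mathcal{N}(0,\frac{\epsilon^2}{2m}I_m)$ independent of each other (so $\mathbb{E}[ee^*]=\frac{\epsilon^2}{m}I_m$), with $\epsilon>0$. The vector $x$, the noise $e$ and the nodes $(t_l)$ are independent. $A^\dagger$ denotes the Moore–Penrose inverse and $\|\cdot\|$ the Euclidean norm. The nonzero singular values of $A$ are listed in decreasing order $\sigma_1(A)\ge\dots\ge\sigma_r(A)>0$.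
   Formalization: The claim is proved for q ≥ 1 and 2 ≤ m < 2N; outside this range it is false: for q = 0 or m = 1 the value σ_r is constant, and for m ≥ 2N node clusters are too unlikely, so both expectations are finite. *)

theory Defs
  imports "HOL-Probability.Probability"
begin

(* Rows are indexed by the finite type 'm (so m = CARD('m)), columns by the finite type 'n.
   The map \<kappa> labels the columns by their frequencies; it is meant to be a bijection onto
   {-q..q}, which forces N = CARD('n) = 2q + 1. *)
definition fourier_matrix :: "('n::finite \<Rightarrow> int) \<Rightarrow> ('m::finite \<Rightarrow> real) \<Rightarrow> complex ^ 'n ^ 'm" where
  "fourier_matrix \<kappa> \<tau> =
     (\<chi> l k. exp (2 * complex_of_real pi * \<i> * of_int (\<kappa> k) * complex_of_real (\<tau> l)))"

definition conj_transpose :: "complex ^ 'n ^ 'm \<Rightarrow> complex ^ 'm ^ 'n" where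
  "conj_transpose A = (\<chi> i j. cnj (A $ j $ i))"

definition is_singular_value :: "complex ^ 'n::finite ^ 'm::finite \<Rightarrow> real \<Rightarrow> bool" where
  "is_singular_value A s \<longleftrightarrow>
     s \<ge> 0 \<and> (\<exists>v. v \<noteq> 0 \<and> (conj_transpose A ** A) *v v = complex_of_real (s\<^sup>2) *s v)"

(* This is the last entry, of index rank A, in the decreasing list of the nonzero singular values.
   The set below is finite, and it is nonempty unless A = 0.

   For a Fourier matrix with independent uniform nodes, 1 / (this value)^2 cannot have infinite
   expectation for every m and N. For N = 1 the value is sqrt m, and for m = 1 it is sqrt N. For m
   large compared with N, degenerate node configurations are too unlikely: for m >= N,
   m nodes within distance d of each other
   have probability of order d^(m - 1) and squared smallest singular value of order d^(2(N - 1)),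
   which gives an infinite expectation exactly when m - 1 <= 2(N - 1). Hence the range
   N >= 3 (that is, q >= 1) and 2 <= m < 2N. *)
definition smallest_nonzero_singular_value :: "complex ^ 'n::finite ^ 'm::finite \<Rightarrow> real" where
  "smallest_nonzero_singular_value A = Min {s. is_singular_value A s \<and> s \<noteq> 0}"

definition is_moore_penrose_inverse ::
    "complex ^ 'n::finite ^ 'm::finite \<Rightarrow> complex ^ 'm ^ 'n \<Rightarrow> bool" where
  "is_moore_penrose_inverse A B \<longleftrightarrow>
     A ** B ** A = A \<and> B ** A ** B = B \<and>
     conj_transpose (A ** B) = A ** B \<and> conj_transpose (B ** A) = B ** A"

definition moore_penrose_inverse :: "complex ^ 'n::finite ^ 'm::finite \<Rightarrow> complex ^ 'm ^ 'n" where
  "moore_penrose_inverse A = (THE B. is_moore_penrose_inverse A B)"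

(* Density of the centred Gaussian on real ^ 'm with covariance matrix s^2 I; the parameter s is
   the standard deviation. *)
definition isotropic_normal_density :: "real \<Rightarrow> real ^ 'm::finite \<Rightarrow> real" where
  "isotropic_normal_density s v = (\<Prod>l\<in>UNIV. normal_density 0 s (v $ l))"

(* Mutual independence of three random variables with values in possibly different types; this is
   the definition of indep_vars for a three-element index set, which only covers a common type. *)
definition (in prob_space) indep_three ::
    "'b measure \<Rightarrow> ('a \<Rightarrow> 'b) \<Rightarrow> 'c measure \<Rightarrow> ('a \<Rightarrow> 'c) \<Rightarrow> 'd measure \<Rightarrow> ('a \<Rightarrow> 'd) \<Rightarrow> bool" where
  "indep_three N1 X1 N2 X2 N3 X3 \<longleftrightarrow>
     random_variable N1 X1 \<and> random_variable N2 X2 \<and> random_variable N3 X3 \<and>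
     indep_sets (\<lambda>i. if i = 1 then {X1 -` S \<inter> space M | S. S \<in> sets N1}
                     else if i = 2 then {X2 -` S \<inter> space M | S. S \<in> sets N2}
                     else {X3 -` S \<inter> space M | S. S \<in> sets N3}) {1::nat, 2, 3}"

end

theory Submission
  imports Defs
begin

text \<open>Almost surely the nodes are distinct, so that \<open>A\<close> has full rank and \<open>A\<^sup>\<dagger>\<close> is given by a
  rational, hence measurable, formula in the entries of \<open>A\<close> and their conjugates. Both
  expectations are bounded below by the expected squared norm of a column of \<open>A\<^sup>\<dagger>\<close>: the first
  since \<open>\<sigma>\<^sub>r \<parallel>A\<^sup>\<dagger> w\<parallel> \<le> \<parallel>w\<parallel>\<close>, the second since the law of \<open>(x, e, t)\<close> is invariant under a sign
  change of one coordinate of \<open>e\<close>, and \<open>e\<close> is independent of \<open>t\<close>. If \<open>m \<le> N\<close>, two nodes at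
  distance \<open>d\<close> force a column of size at least of order \<open>1 / d\<close>. If \<open>m > N\<close>, the coefficient
  vector of \<open>(z - z\<^sub>a) ^ (N - 1)\<close> shows that nodes in a cluster of diameter \<open>d\<close> force
  \<open>\<parallel>A\<^sup>\<dagger>\<parallel>\<^sup>2\<close> to be at least of order \<open>d ^ - (2 N - 2)\<close>. Such clusters at the scales \<open>d = 4 ^ - n\<close>
  have probability of order \<open>d\<close> and \<open>d ^ (m - 1)\<close> respectively, so that, as \<open>m < 2 N\<close>, every
  scale contributes at least a fixed positive amount.\<close>

section \<open>Singular values and the pseudoinverse\<close>

lemma linear_matrix_vector_mult: "linear ((*v) A)" for A :: "complex ^ 'n::finite ^ 'm::finite"
  by (rule matrix_vector_mul_linear)

lemma inner_complex_mult: "inner (a * z) w = inner z (cnj a * w)" for a z w :: complex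
  by (simp add: inner_complex_def algebra_simps)

text \<open>\<open>inner\<close> is the real inner product on complex vectors, that is, the real
  part of the Hermitian one. Taking real parts in the usual adjoint identity loses nothing that is
  used later, since norms and vanishing of vectors are determined by it.\<close>

lemma inner_conj_transpose: "inner (A *v v) w = inner v (conj_transpose A *v w)"
proof -
  have "inner (A *v v) w = (\<Sum>i\<in>UNIV. \<Sum>j\<in>UNIV. inner (v $ j) (cnj (A $ i $ j) * w $ i))"
    by (simp add: inner_vec_def matrix_vector_mult_def inner_sum_left inner_complex_mult)
  also have "\<dots> = (\<Sum>j\<in>UNIV. \<Sum>i\<in>UNIV. inner (v $ j) (cnj (A $ i $ j) * w $ i))"
    by (rule sum.swap)
  also have "\<dots> = inner v (conj_transpose A *v w)"
    by (simp add: inner_vec_def matrix_vector_mult_def inner_sum_right conj_transpose_def)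
  finally show ?thesis .
qed

lemma conj_transpose_conj_transpose [simp]: "conj_transpose (conj_transpose A) = A"
  by (simp add: conj_transpose_def vec_eq_iff)

lemma conj_transpose_mult:
  "conj_transpose (A ** B) = conj_transpose B ** conj_transpose A"
  by (simp add: conj_transpose_def matrix_matrix_mult_def vec_eq_iff mult.commute)

lemma conj_transpose_mat_1 [simp]: "conj_transpose (mat 1) = mat 1"
  by (simp add: conj_transpose_def mat_def vec_eq_iff)

lemma vector_smult_complex_of_real: "complex_of_real c *s v = c *\<^sub>R v"
  by (simp add: vec_eq_iff scaleR_conv_of_real[where 'a = complex])

lemma norm_vector_smult: "norm (c *s v) = norm c * norm v" for v :: "complex ^ 'n::finite"
  by (simp add: norm_vec_def norm_mult L2_set_right_distrib)

text \<open>Penrose's uniqueness argument: \<open>A ** B\<close> and \<open>A ** C\<close> are both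
  the orthogonal projection onto the range of \<open>A\<close>, so they agree, and likewise
  \<open>B ** A\<close> and \<open>C ** A\<close>. Then
  \<open>B = B ** A ** B = C ** A ** C = C\<close>.\<close>

lemma moore_penrose_inverse_eqI:
  assumes "is_moore_penrose_inverse A B"
  shows "moore_penrose_inverse A = B"
  unfolding moore_penrose_inverse_def
proof (rule the_equality[of "is_moore_penrose_inverse A", OF assms])
  fix C assume C: "is_moore_penrose_inverse A C"
  note b = assms[unfolded is_moore_penrose_inverse_def] and c = C[unfolded is_moore_penrose_inverse_def]
  have "A ** B = conj_transpose ((A ** C) ** (A ** B))"
    using b c by (simp add: matrix_mul_assoc)
  also have "\<dots> = (A ** B) ** (A ** C)"
    using b c by (simp add: conj_transpose_mult)
  also have "\<dots> = A ** C"
    using b by (simp add: matrix_mul_assoc)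
  finally have AB: "A ** B = A ** C" .
  have "B ** A = conj_transpose ((B ** A) ** (C ** A))"
    using b c by (metis matrix_mul_assoc)
  also have "\<dots> = (C ** A) ** (B ** A)"
    using b c by (simp add: conj_transpose_mult)
  also have "\<dots> = C ** A"
    using b by (metis matrix_mul_assoc)
  finally have BA: "B ** A = C ** A" .
  show "C = B"
    using b c AB BA by (metis matrix_mul_assoc)
qed

text \<open>Eigenvectors of the self-adjoint \<open>conj_transpose A ** A\<close> for different
  eigenvalues are orthogonal, hence independent; nonnegativity makes \<open>s\<close> recoverable
  from its square. Finiteness turns the \<open>Min\<close> in the definition of the smallest
  singular value into a true minimum.\<close>

lemma finite_singular_values: "finite {s. is_singular_value A s}"
  for A :: "complex ^ 'n::finite ^ 'm::finite"
proof -
  let ?S = "{s. is_singular_value A s}" and ?T = "conj_transpose A ** A"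
  have "\<forall>s\<in>?S. \<exists>v. s \<ge> 0 \<and> v \<noteq> 0 \<and> ?T *v v = s\<^sup>2 *\<^sub>R v"
    by (simp add: is_singular_value_def vector_smult_complex_of_real del: of_real_power)
  then obtain v where v: "\<And>s. s \<in> ?S \<Longrightarrow> s \<ge> 0 \<and> v s \<noteq> 0 \<and> ?T *v v s = s\<^sup>2 *\<^sub>R v s"
    unfolding bchoice_iff by blast
  have orth: "inner (v r) (v s) = 0" if "r \<in> ?S" "s \<in> ?S" "r \<noteq> s" for r s
  proof -
    have "conj_transpose ?T = ?T" by (simp add: conj_transpose_mult)
    then have "inner (?T *v v r) (v s) = inner (v r) (?T *v v s)"
      by (simp add: inner_conj_transpose)
    then have "r\<^sup>2 * inner (v r) (v s) = s\<^sup>2 * inner (v r) (v s)"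
      using v[OF that(1)] v[OF that(2)] by simp
    moreover have "r\<^sup>2 \<noteq> s\<^sup>2"
      using that v by (metis power2_eq_imp_eq)
    ultimately show ?thesis by simp
  qed
  have inj: "inj_on v ?S"
    using orth v by (metis inj_onI inner_eq_zero_iff)
  have "pairwise orthogonal (v ` ?S)"
    using orth by (auto simp: pairwise_def orthogonal_def)
  moreover have "0 \<notin> v ` ?S"
    using v by force
  ultimately have "finite (v ` ?S)"
    by (intro finiteI_independent pairwise_orthogonal_independent)
  then show ?thesis
    using inj by (simp add: finite_image_iff)
qed

text \<open>\<open>A ** B\<close> is self-adjoint and idempotent, that is, an orthogonal projection,
  and such maps are contractions.\<close>

lemma norm_moore_penrose_projection_le:
  assumes "is_moore_penrose_inverse A B"
  shows "norm (A *v (B *v w)) \<le> norm w"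
proof -
  let ?P = "A ** B"
  have P: "conj_transpose ?P = ?P" "?P ** ?P = ?P"
    using assms by (simp_all add: is_moore_penrose_inverse_def matrix_mul_assoc)
  have "inner (?P *v w) (?P *v w) = inner w (?P *v w)"
    by (metis P inner_conj_transpose matrix_vector_mul_assoc)
  also have "\<dots> \<le> norm w * norm (?P *v w)"
    by (rule norm_cauchy_schwarz)
  finally have "norm (?P *v w) * norm (?P *v w) \<le> norm w * norm (?P *v w)"
    by (simp add: power2_norm_eq_inner[symmetric] power2_eq_square)
  then have "norm (?P *v w) \<le> norm w"
    by (metis mult_right_le_imp_le norm_ge_zero norm_zero order_le_less)
  then show ?thesis
    by (simp add: matrix_vector_mul_assoc)
qed

text \<open>A minimiser of \<open>\<parallel>A v\<parallel>\<close> on the unit sphere of the row space is an eigenvector of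
  \<open>A\<^sup>* A\<close>, and the row space is the fixed space of \<open>B A\<close>.\<close>

lemma singular_value_on_row_space:
  fixes A :: "complex ^ 'n::finite ^ 'm::finite"
  assumes B: "is_moore_penrose_inverse A B" and "A \<noteq> 0"
  obtains s where "is_singular_value A s" "s > 0" "\<And>w. s * norm (B *v w) \<le> norm w"
proof -
  note b = B[unfolded is_moore_penrose_inverse_def]
  define S where "S = {v. B *v (A *v v) = v}"
  have sub: "subspace S"
    by (auto simp: subspace_def S_def linear_add[OF linear_matrix_vector_mult]
        linear_cmul[OF linear_matrix_vector_mult])
  have BS: "B *v w \<in> S" for w
    using b by (simp add: S_def matrix_vector_mul_assoc matrix_mul_assoc)
  have TS: "conj_transpose A *v (A *v v) \<in> S" for v
  proof -
    \<comment> \<open>Adjoint of \<open>A ** B ** A = A\<close>, with \<open>B ** A\<close>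
      self-adjoint.\<close>
    have "B ** A ** conj_transpose A = conj_transpose A"
      using b by (metis conj_transpose_mult matrix_mul_assoc)
    then show ?thesis
      unfolding S_def mem_Collect_eq matrix_vector_mul_assoc matrix_mul_assoc by simp
  qed
  have cont: "continuous_on X ((*v) C)" for X and C :: "complex ^ 'k::finite ^ 'l::finite"
    by (intro linear_continuous_on matrix_vector_mul_bounded_linear)
  obtain u where u: "A *v u \<noteq> 0"
    using \<open>A \<noteq> 0\<close> by (metis matrix_eq matrix_vector_mult_0)
  define u' where "u' = B *v (A *v u)"
  have "A *v u' = A *v u"
    using b by (simp add: u'_def matrix_vector_mul_assoc matrix_mul_assoc)
  then have u': "u' \<in> S" "u' \<noteq> 0"
    using u BS by (auto simp: u'_def)
  have "(1 / norm u') *\<^sub>R u' \<in> sphere 0 1 \<inter> S"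
    using u' sub by (simp add: subspace_mul)
  then have ne: "sphere 0 1 \<inter> S \<noteq> {}" by blast
  have "compact (sphere 0 1 \<inter> S)"
    using sub by (intro compact_Int_closed closed_subspace) auto
  then obtain v where v: "v \<in> sphere 0 1 \<inter> S"
    and min: "\<And>z. z \<in> sphere 0 1 \<inter> S \<Longrightarrow> norm (A *v v) \<le> norm (A *v z)"
    using continuous_attains_inf[OF _ ne continuous_on_norm[OF cont[of _ A]]] by blast
  define s where "s = norm (A *v v)"
  have nv: "norm v = 1" and vS: "v \<in> S" using v by auto
  have "A *v v \<noteq> 0"
  proof
    assume "A *v v = 0"
    then have "v = 0" using vS by (simp add: S_def)
    then show False using nv by simp
  qed
  then have "s > 0" by (simp add: s_def)
  have low: "s * norm z \<le> norm (A *v z)" if "z \<in> S" for z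
  proof (cases "z = 0")
    case False
    have "s \<le> norm (A *v ((1 / norm z) *\<^sub>R z))"
      unfolding s_def using False that sub by (intro min) (simp add: subspace_mul)
    also have "\<dots> = norm (A *v z) / norm z"
      by (simp add: linear_cmul[OF linear_matrix_vector_mult])
    finally show ?thesis using False by (simp add: field_simps)
  qed simp
  have ortho: "inner (A *v v) (A *v z) = s\<^sup>2 * inner v z" if z: "z \<in> S" for z
  proof -
    define c where "c = inner (A *v v) (A *v z) - s\<^sup>2 * inner v z"
    define d where "d = (norm (A *v z))\<^sup>2 - s\<^sup>2 * (norm z)\<^sup>2"
    \<comment> \<open>Minimality is tested along the line through \<open>v\<close> in direction
      \<open>z\<close>. The constant terms cancel because \<open>norm v = 1\<close> and
      \<open>norm (A *v v) = s\<close>; a quadratic without constant term that is nonnegative on all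
      reals has no linear term.\<close>
    have q: "0 \<le> 2 * x * c + x\<^sup>2 * d" for x :: real
    proof -
      have "v + x *\<^sub>R z \<in> S" using vS z sub by (simp add: subspace_add subspace_mul)
      from low[OF this] have "(s * norm (v + x *\<^sub>R z))\<^sup>2 \<le> (norm (A *v (v + x *\<^sub>R z)))\<^sup>2"
        using \<open>s > 0\<close> by (intro power_mono) auto
      moreover have "(norm (v + x *\<^sub>R z))\<^sup>2 = 1 + 2 * x * inner v z + x\<^sup>2 * (norm z)\<^sup>2"
        using nv unfolding power2_norm_eq_inner norm_eq_1
        by (simp add: inner_add inner_commute algebra_simps power2_eq_square)
      moreover have "(norm (A *v (v + x *\<^sub>R z)))\<^sup>2 =
          s\<^sup>2 + 2 * x * inner (A *v v) (A *v z) + x\<^sup>2 * (norm (A *v z))\<^sup>2"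
        unfolding s_def power2_norm_eq_inner linear_add[OF linear_matrix_vector_mult]
          linear_cmul[OF linear_matrix_vector_mult]
        by (simp add: inner_add inner_commute algebra_simps power2_eq_square)
      ultimately show ?thesis
        by (simp add: c_def d_def power_mult_distrib algebra_simps)
    qed
    have "d \<ge> 0"
      using q[of 1] q[of "-1"] by simp
    have "c = 0"
    proof (rule ccontr)
      assume "c \<noteq> 0"
      \<comment> \<open>Near the minimiser \<open>- c / d\<close> of the quadratic, with
        \<open>d + 1\<close> in place of \<open>d\<close> because \<open>d\<close> may be
        zero.\<close>
      have "0 \<le> 2 * (- c / (d + 1)) * c + (- c / (d + 1))\<^sup>2 * d" by (rule q)
      also have "\<dots> = - (c\<^sup>2 * (d + 2)) / (d + 1)\<^sup>2"
        using \<open>d \<ge> 0\<close> by (simp add: divide_simps power2_eq_square) (simp add: algebra_simps)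
      also have "\<dots> < 0"
        using \<open>c \<noteq> 0\<close> \<open>d \<ge> 0\<close> by (intro divide_neg_pos) (auto intro!: mult_pos_pos)
      finally show False by simp
    qed
    then show ?thesis by (simp add: c_def)
  qed
  have eig: "conj_transpose A *v (A *v v) = s\<^sup>2 *\<^sub>R v"
  proof -
    \<comment> \<open>The residual of the eigenvalue equation lies in \<open>S\<close>, and the
      first-order condition says that it is orthogonal to all of \<open>S\<close>, hence to
      itself.\<close>
    define r where "r = conj_transpose A *v (A *v v) - s\<^sup>2 *\<^sub>R v"
    have rS: "r \<in> S" using TS vS sub by (simp add: r_def subspace_diff subspace_mul)
    have "inner r r = inner (conj_transpose A *v (A *v v)) r - s\<^sup>2 * inner v r"
      by (metis inner_diff_left inner_scaleR_left r_def)
    also have "inner (conj_transpose A *v (A *v v)) r = inner (A *v v) (A *v r)"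
      by (metis inner_commute inner_conj_transpose)
    finally have "inner r r = 0" using ortho[OF rS] by simp
    then show ?thesis by (simp add: r_def)
  qed
  show thesis
  proof (rule that)
    show "is_singular_value A s"
      unfolding is_singular_value_def vector_smult_complex_of_real
      using \<open>s > 0\<close> eig nv by (auto simp: matrix_vector_mul_assoc intro!: exI[of _ v])
    show "s * norm (B *v w) \<le> norm w" for w
      using low[OF BS] norm_moore_penrose_projection_le[OF B] by (rule order_trans)
  qed fact
qed

text \<open>The singular value found on the row space is one of those over which the minimum is
  taken, so its inequality holds a fortiori for the smallest one. With \<open>w\<close> a coordinate
  vector this bounds a column of the pseudoinverse.\<close>

lemma smallest_nonzero_singular_value_bound:
  assumes "is_moore_penrose_inverse A B" "A \<noteq> 0"
  shows "(norm (B *v w))\<^sup>2 \<le> (norm w)\<^sup>2 * (1 / (smallest_nonzero_singular_value A)\<^sup>2)"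
proof -
  obtain s where s: "is_singular_value A s" "s > 0" "\<And>w. s * norm (B *v w) \<le> norm w"
    using singular_value_on_row_space[OF assms] by blast
  let ?X = "{s. is_singular_value A s \<and> s \<noteq> 0}" and ?\<sigma> = "smallest_nonzero_singular_value A"
  have X: "finite ?X" "s \<in> ?X"
    using finite_singular_values[of A] s by (auto elim: rev_finite_subset)
  then have "?\<sigma> \<in> ?X"
    unfolding smallest_nonzero_singular_value_def by (intro Min_in) auto
  then have pos: "?\<sigma> > 0" by (auto simp: is_singular_value_def)
  have "?\<sigma> \<le> s"
    unfolding smallest_nonzero_singular_value_def using X by (intro Min_le)
  then have "?\<sigma> * norm (B *v w) \<le> norm w"
    using s(3)[of w] by (meson mult_right_mono norm_ge_zero order_trans)
  then have "(?\<sigma> * norm (B *v w))\<^sup>2 \<le> (norm w)\<^sup>2"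
    using pos by (intro power_mono) auto
  then show ?thesis using pos by (simp add: field_simps power_mult_distrib)
qed

section \<open>Explicit pseudoinverses of matrices of full rank\<close>

definition cramer_inverse :: "'a::field ^ 'n ^ 'n \<Rightarrow> 'a ^ 'n ^ 'n::finite" where
  "cramer_inverse G =
     (\<chi> k l. det (\<chi> i j. if j = k then axis l 1 $ i else G $ i $ j) / det G)"

text \<open>Cramer's rule, solved for each column of the identity. An inverse written with
  determinants depends measurably on the entries of \<open>G\<close> by inspection.\<close>

lemma cramer_inverse:
  fixes G :: "'a::field ^ 'n::finite ^ 'n"
  assumes "det G \<noteq> 0"
  shows "G ** cramer_inverse G = mat 1" "cramer_inverse G ** G = mat 1"
proof -
  have col: "G *v (column l (cramer_inverse G)) = axis l 1" for l
    unfolding cramer[OF assms] by (simp add: column_def cramer_inverse_def)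
  have "(G ** cramer_inverse G) $ i $ l = (mat 1 :: 'a ^ 'n ^ 'n) $ i $ l" for i l
    using arg_cong[OF col[of l], of "\<lambda>v. v $ i"]
    by (simp add: matrix_matrix_mult_def matrix_vector_mult_def column_def axis_def mat_def)
  then show "G ** cramer_inverse G = mat 1" by (simp add: vec_eq_iff)
  then show "cramer_inverse G ** G = mat 1" by (simp add: matrix_left_right_inverse)
qed

text \<open>A kernel vector \<open>v\<close> of the Gram matrix satisfies
  \<open>inner (A *v v) (A *v v) = 0\<close>, so it is a kernel vector of \<open>A\<close>.\<close>

lemma det_gram_nonzero:
  assumes "\<And>v. A *v v = 0 \<Longrightarrow> v = 0"
  shows "det (conj_transpose A ** A) \<noteq> 0"
proof -
  have "v = 0" if "(conj_transpose A ** A) *v v = 0" for v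
  proof -
    have "inner (A *v v) (A *v v) = inner v ((conj_transpose A ** A) *v v)"
      by (simp add: inner_conj_transpose matrix_vector_mul_assoc)
    then show ?thesis using that assms by simp
  qed
  then show ?thesis
    by (metis invertible_det_nz invertible_left_inverse matrix_left_invertible_ker)
qed

lemma cramer_inverse_hermitian:
  assumes "det G \<noteq> 0" "conj_transpose G = G"
  shows "conj_transpose (cramer_inverse G) = cramer_inverse G"
proof -
  have "conj_transpose (cramer_inverse G) ** G = mat 1"
    using cramer_inverse(1)[OF assms(1)] assms(2) by (metis conj_transpose_mult conj_transpose_mat_1)
  then show ?thesis
    using cramer_inverse(1)[OF assms(1)] by (metis matrix_mul_assoc matrix_mul_lid matrix_mul_rid)
qed

text \<open>The classical formulas for full row rank and for full column rank, chosen by the shape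
  of the matrix. It is total, so its measurability needs no rank condition, but it is shown to be
  the pseudoinverse only for full rank.\<close>

definition full_rank_pinv :: "complex ^ 'n::finite ^ 'm::finite \<Rightarrow> complex ^ 'm ^ 'n" where
  "full_rank_pinv A = (if CARD('m) \<le> CARD('n)
     then conj_transpose A ** cramer_inverse (A ** conj_transpose A)
     else cramer_inverse (conj_transpose A ** A) ** conj_transpose A)"

text \<open>A one-sided inverse already yields three Penrose conditions; the fourth comes from the
  Gram matrix and its inverse being Hermitian. The case of full column rank below is
  symmetric.\<close>

lemma full_rank_pinv_right:
  fixes A :: "complex ^ 'n::finite ^ 'm::finite"
  assumes "CARD('m) \<le> CARD('n)" "\<And>w. conj_transpose A *v w = 0 \<Longrightarrow> w = 0"
  shows "is_moore_penrose_inverse A (full_rank_pinv A)" "A ** full_rank_pinv A = mat 1"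
proof -
  have nz: "det (A ** conj_transpose A) \<noteq> 0"
    using det_gram_nonzero[of "conj_transpose A"] assms(2) by simp
  show 1: "A ** full_rank_pinv A = mat 1"
    using assms(1) cramer_inverse[OF nz] by (simp add: full_rank_pinv_def matrix_mul_assoc)
  have "conj_transpose (full_rank_pinv A ** A) = full_rank_pinv A ** A"
    using assms(1) cramer_inverse_hermitian[OF nz]
    by (simp add: full_rank_pinv_def conj_transpose_mult matrix_mul_assoc)
  then show "is_moore_penrose_inverse A (full_rank_pinv A)"
    using 1 by (simp add: is_moore_penrose_inverse_def flip: matrix_mul_assoc)
qed

lemma full_rank_pinv_left:
  fixes A :: "complex ^ 'n::finite ^ 'm::finite"
  assumes "CARD('n) < CARD('m)" "\<And>v. A *v v = 0 \<Longrightarrow> v = 0"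
  shows "is_moore_penrose_inverse A (full_rank_pinv A)" "full_rank_pinv A ** A = mat 1"
proof -
  have nz: "det (conj_transpose A ** A) \<noteq> 0"
    using det_gram_nonzero assms(2) by blast
  show 1: "full_rank_pinv A ** A = mat 1"
    using assms(1) cramer_inverse[OF nz] by (simp add: full_rank_pinv_def flip: matrix_mul_assoc)
  have "conj_transpose (A ** full_rank_pinv A) = A ** full_rank_pinv A"
    using assms(1) cramer_inverse_hermitian[OF nz]
    by (simp add: full_rank_pinv_def conj_transpose_mult matrix_mul_assoc)
  then show "is_moore_penrose_inverse A (full_rank_pinv A)"
    using 1 by (simp add: is_moore_penrose_inverse_def flip: matrix_mul_assoc)
qed

text \<open>Triangle inequality over the columns, then Cauchy-Schwarz on the sum of their norms. The
  factor \<open>CARD('m)\<close> is lossy, but only orders of magnitude in the cluster diameter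
  matter.\<close>

lemma norm_mult_vec_le_columns:
  fixes B :: "complex ^ 'm::finite ^ 'n::finite"
  shows "(norm (B *v w))\<^sup>2 \<le> (norm w)\<^sup>2 * (real CARD('m) * (\<Sum>l\<in>UNIV. (norm (column l B))\<^sup>2))"
proof -
  have "norm (B *v w) \<le> (\<Sum>l\<in>UNIV. norm (w $ l *s column l B))"
    unfolding matrix_mult_sum by (rule norm_sum)
  also have "\<dots> \<le> (\<Sum>l\<in>UNIV. norm w * norm (column l B))"
  proof (rule sum_mono)
    fix l
    show "norm (w $ l *s column l B) \<le> norm w * norm (column l B)"
      unfolding norm_vector_smult
      using mult_right_mono[OF Finite_Cartesian_Product.norm_nth_le[of w l] norm_ge_zero[of "column l B"]] by simp
  qed
  also have "\<dots> = norm w * (\<Sum>l\<in>UNIV. norm (column l B))"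
    by (simp add: sum_distrib_left)
  finally have "(norm (B *v w))\<^sup>2 \<le> (norm w)\<^sup>2 * (\<Sum>l\<in>UNIV. norm (column l B))\<^sup>2"
    by (metis norm_ge_zero power_mono power_mult_distrib)
  also have "\<dots> \<le> (norm w)\<^sup>2 * (real CARD('m) * (\<Sum>l\<in>UNIV. (norm (column l B))\<^sup>2))"
    by (intro mult_left_mono sum_squared_le_sum_of_squares[THEN order_trans]) auto
  finally show ?thesis .
qed

section \<open>Measurability of the explicit pseudoinverse\<close>

lemma measurable_matrix_mult:
  fixes F :: "'a \<Rightarrow> complex ^ 'n::finite ^ 'm::finite" and G :: "'a \<Rightarrow> complex ^ 'k::finite ^ 'n"
  assumes "\<And>i j. (\<lambda>x. F x $ i $ j) \<in> borel_measurable M" "\<And>i j. (\<lambda>x. G x $ i $ j) \<in> borel_measurable M"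
  shows "(\<lambda>x. (F x ** G x) $ i $ j) \<in> borel_measurable M"
  unfolding matrix_matrix_mult_def using assms by simp

lemma measurable_det:
  fixes F :: "'a \<Rightarrow> complex ^ 'n::finite ^ 'n"
  assumes [measurable]: "\<And>i j. (\<lambda>x. F x $ i $ j) \<in> borel_measurable M"
  shows "(\<lambda>x. det (F x)) \<in> borel_measurable M"
  unfolding det_def by measurable

lemma measurable_cramer_inverse:
  fixes F :: "'a \<Rightarrow> complex ^ 'n::finite ^ 'n"
  assumes [measurable]: "\<And>i j. (\<lambda>x. F x $ i $ j) \<in> borel_measurable M"
  shows "(\<lambda>x. cramer_inverse (F x) $ i $ j) \<in> borel_measurable M"
proof -
  have "(\<lambda>x. det (\<chi> i' j'. if j' = i then axis j 1 $ i' else F x $ i' $ j')) \<in> borel_measurable M"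
    by (rule measurable_det) simp
  then show ?thesis
    unfolding cramer_inverse_def using measurable_det[OF assms] by simp
qed

lemma measurable_full_rank_pinv:
  fixes F :: "'a \<Rightarrow> complex ^ 'n::finite ^ 'm::finite"
  assumes F: "\<And>i j. (\<lambda>x. F x $ i $ j) \<in> borel_measurable M"
  shows "(\<lambda>x. full_rank_pinv (F x) $ i $ j) \<in> borel_measurable M"
proof -
  have cF: "(\<lambda>x. conj_transpose (F x) $ i $ j) \<in> borel_measurable M" for i j
    unfolding conj_transpose_def
    using borel_measurable_continuous_onI[OF continuous_on_cnj[OF continuous_on_id]] F
    by (auto intro: measurable_compose)
  show ?thesis
    unfolding full_rank_pinv_def
    by (cases "CARD('m) \<le> CARD('n)")
      (simp_all add: measurable_matrix_mult measurable_cramer_inverse F cF)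
qed

section \<open>Fourier matrices with distinct nodes\<close>

definition unit_node :: "real \<Rightarrow> complex" where
  "unit_node s = exp (2 * complex_of_real pi * \<i> * complex_of_real s)"

lemma norm_unit_node [simp]: "norm (unit_node s) = 1"
  by (simp add: unit_node_def)

lemma unit_node_nonzero [simp]: "unit_node s \<noteq> 0"
  by (simp add: unit_node_def)

lemma inj_on_unit_node: "inj_on unit_node {0..<1}"
proof (rule inj_onI)
  fix x y :: real
  assume xy: "x \<in> {0..<1}" "y \<in> {0..<1}" "unit_node x = unit_node y"
  then obtain n :: int where "2 * complex_of_real pi * \<i> * complex_of_real x =
      2 * complex_of_real pi * \<i> * complex_of_real y + complex_of_real (real_of_int (2 * n) * pi) * \<i>"
    unfolding unit_node_def exp_eq by blast
  then have "2 * complex_of_real pi * \<i> * complex_of_real x = 2 * complex_of_real pi * \<i> * complex_of_real (y + n)"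
    by (simp add: algebra_simps)
  then have "complex_of_real x = complex_of_real (y + n)" by simp
  then have "x = y + n" by (simp only: of_real_eq_iff)
  moreover from this have "real_of_int n < 1" "real_of_int n > - 1" using xy by auto
  then have "n = 0" by linarith
  ultimately show "x = y" by simp
qed

text \<open>A chord of the unit circle is no longer than its arc.\<close>

lemma norm_iexp_diff_le: "norm (iexp x - iexp y) \<le> \<bar>x - y\<bar>"
proof -
  have "iexp x - iexp y = iexp y * (iexp (x - y) - 1)"
    by (simp add: algebra_simps exp_diff)
  then have "norm (iexp x - iexp y) = norm (iexp (x - y) - 1)"
    by (simp add: norm_mult)
  also have "\<dots> \<le> \<bar>x - y\<bar>"
    using iexp_approx1[of "x - y" 0] by simp
  finally show ?thesis .
qed

lemma norm_unit_node_diff_le: "norm (unit_node x - unit_node y) \<le> 2 * pi * \<bar>x - y\<bar>"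
proof -
  have "unit_node s = iexp (2 * pi * s)" for s
    by (simp add: unit_node_def mult_ac)
  then have "norm (unit_node x - unit_node y) \<le> \<bar>2 * pi * x - 2 * pi * y\<bar>"
    by (simp add: norm_iexp_diff_le del: of_real_mult)
  also have "\<dots> = 2 * pi * \<bar>x - y\<bar>"
    by (simp add: abs_mult flip: right_diff_distrib)
  finally show ?thesis .
qed

lemma norm_fourier_matrix_diff_le:
  "norm (fourier_matrix \<kappa> \<tau> $ a $ k - fourier_matrix \<kappa> \<tau> $ b $ k)
     \<le> 2 * pi * \<bar>real_of_int (\<kappa> k)\<bar> * \<bar>\<tau> a - \<tau> b\<bar>"
proof -
  have "fourier_matrix \<kappa> \<tau> $ l $ k = iexp (2 * pi * \<kappa> k * \<tau> l)" for l
    by (simp add: fourier_matrix_def mult_ac)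
  then have "norm (fourier_matrix \<kappa> \<tau> $ a $ k - fourier_matrix \<kappa> \<tau> $ b $ k)
      \<le> \<bar>2 * pi * \<kappa> k * \<tau> a - 2 * pi * \<kappa> k * \<tau> b\<bar>"
    by (simp add: norm_iexp_diff_le del: of_real_mult)
  also have "\<dots> = 2 * pi * \<bar>real_of_int (\<kappa> k)\<bar> * \<bar>\<tau> a - \<tau> b\<bar>"
    by (simp add: abs_mult flip: right_diff_distrib)
  finally show ?thesis .
qed

lemma fourier_matrix_nonzero: "fourier_matrix \<kappa> \<tau> \<noteq> 0"
proof
  assume "fourier_matrix \<kappa> \<tau> = 0"
  then have "fourier_matrix \<kappa> \<tau> $ l $ k = 0" for l k by simp
  then show False by (simp add: fourier_matrix_def)
qed

section \<open>Fourier matrices as evaluation of polynomials on the unit circle\<close>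

locale symmetric_frequencies =
  fixes \<kappa> :: "'n::finite \<Rightarrow> int" and q :: nat
  assumes bij: "bij_betw \<kappa> UNIV {- int q..int q}"
begin

text \<open>Multiplying a row by the \<open>q\<close>-th power of its node moves the frequencies
  \<open>-q..q\<close> to the exponents \<open>0..2q\<close>, so trigonometric polynomials become
  ordinary ones.\<close>

definition shifted :: "'n \<Rightarrow> nat" where
  "shifted k = nat (\<kappa> k + int q)"

lemma bij_shifted: "bij_betw shifted UNIV {..2 * q}"
proof -
  have "bij_betw (\<lambda>j. nat (j + int q)) {- int q..int q} {..2 * q}"
    by (rule bij_betwI[where g = "\<lambda>i. int i - int q"]) auto
  from bij_betw_trans[OF bij this] show ?thesis
    by (simp add: shifted_def[abs_def] comp_def)
qed

lemma card_frequencies: "CARD('n) = 2 * q + 1"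
  using bij_betw_same_card[OF bij_shifted] by simp

lemma abs_frequency_le: "\<bar>real_of_int (\<kappa> k)\<bar> \<le> real q"
proof -
  have "\<kappa> k \<in> {- int q..int q}" using bij by (auto simp: bij_betw_def)
  then show ?thesis by (auto simp: abs_if)
qed

lemma shift_entry: "unit_node (\<tau> l) ^ q * fourier_matrix \<kappa> \<tau> $ l $ k = unit_node (\<tau> l) ^ shifted k"
proof -
  have "\<kappa> k \<in> {- int q..int q}" using bij by (auto simp: bij_betw_def)
  then have "real (shifted k) = real q + real_of_int (\<kappa> k)" by (simp add: shifted_def)
  then have "(of_nat (shifted k) :: complex) = of_nat q + of_int (\<kappa> k)"
    by (metis of_real_add of_real_of_int_eq of_real_of_nat_eq)
  then show ?thesis
    by (simp add: unit_node_def fourier_matrix_def exp_of_nat_mult[symmetric] exp_add[symmetric] algebra_simps)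
qed

definition coeff_vec :: "complex poly \<Rightarrow> complex ^ 'n" where
  "coeff_vec p = (\<chi> k. coeff p (shifted k))"

text \<open>Up to a factor of modulus one in each row the matrix is a Vandermonde matrix, so it
  evaluates polynomials at the nodes. The factor affects neither zeros nor norms.\<close>

lemma fourier_matrix_mult_coeff_vec:
  assumes "degree p \<le> 2 * q"
  shows "unit_node (\<tau> l) ^ q * (fourier_matrix \<kappa> \<tau> *v coeff_vec p) $ l = poly p (unit_node (\<tau> l))"
proof -
  have "unit_node (\<tau> l) ^ q * (fourier_matrix \<kappa> \<tau> *v coeff_vec p) $ l =
      (\<Sum>k\<in>UNIV. (unit_node (\<tau> l) ^ q * fourier_matrix \<kappa> \<tau> $ l $ k) * coeff p (shifted k))"
    by (simp add: matrix_vector_mult_def coeff_vec_def sum_distrib_left mult.assoc)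
  also have "\<dots> = (\<Sum>k\<in>UNIV. coeff p (shifted k) * unit_node (\<tau> l) ^ shifted k)"
    by (simp add: shift_entry mult.commute)
  also have "\<dots> = (\<Sum>i\<le>2 * q. coeff p i * unit_node (\<tau> l) ^ i)"
    using sum.reindex_bij_betw[OF bij_shifted] .
  also have "\<dots> = poly p (unit_node (\<tau> l))"
    unfolding poly_altdef using assms by (intro sum.mono_neutral_right) (auto simp: coeff_eq_0)
  finally show ?thesis .
qed

lemma coeff_vec_surj: "\<exists>p. degree p \<le> 2 * q \<and> coeff_vec p = v"
proof (intro exI conjI)
  let ?p = "\<Sum>k\<in>UNIV. monom (v $ k) (shifted k)"
  have "shifted k \<le> 2 * q" for k using bij_shifted by (auto simp: bij_betw_def)
  then show "degree ?p \<le> 2 * q"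
    by (intro degree_sum_le) (auto intro: order_trans[OF degree_monom_le])
  have inj: "inj shifted" using bij_shifted by (simp add: bij_betw_def)
  show "coeff_vec ?p = v"
    by (simp add: vec_eq_iff coeff_vec_def coeff_sum inj_eq[OF inj] if_distrib cong: if_cong)
qed

text \<open>A kernel vector is a polynomial of degree at most \<open>2 * q = N - 1\<close> with
  \<open>m >= N\<close> distinct roots, hence zero.\<close>

lemma fourier_matrix_injective:
  fixes \<tau> :: "'m::finite \<Rightarrow> real"
  assumes "inj \<tau>" "range \<tau> \<subseteq> {0..<1}" "CARD('n) \<le> CARD('m)" "fourier_matrix \<kappa> \<tau> *v v = 0"
  shows "v = 0"
proof -
  obtain p where p: "degree p \<le> 2 * q" "coeff_vec p = v" using coeff_vec_surj by blast
  have z: "inj (\<lambda>l. unit_node (\<tau> l))"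
    using comp_inj_on[OF assms(1) inj_on_subset[OF inj_on_unit_node assms(2)]] by (simp add: comp_def)
  have root: "poly p (unit_node (\<tau> l)) = 0" for l
    using fourier_matrix_mult_coeff_vec[OF p(1), of \<tau> l] p(2) assms(4) by simp
  have "p = 0"
  proof (rule ccontr)
    assume "p \<noteq> 0"
    then have "card (range (\<lambda>l. unit_node (\<tau> l))) \<le> card {x. poly p x = 0}"
      using root by (intro card_mono poly_roots_finite) auto
    also have "\<dots> \<le> degree p" using \<open>p \<noteq> 0\<close> by (rule card_poly_roots_bound)
    finally show False using p(1) assms(3) card_frequencies by (simp add: card_image[OF z])
  qed
  then show ?thesis using p(2) by (auto simp: coeff_vec_def vec_eq_iff)
qed

text \<open>For \<open>m <= N\<close> Lagrange interpolation reaches every value vector at the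
  nodes. A vector killed by the adjoint is orthogonal to the range, hence to everything.\<close>

lemma fourier_matrix_adjoint_injective:
  fixes \<tau> :: "'m::finite \<Rightarrow> real"
  assumes "inj \<tau>" "range \<tau> \<subseteq> {0..<1}" "CARD('m) \<le> CARD('n)"
    and w: "conj_transpose (fourier_matrix \<kappa> \<tau>) *v w = 0"
  shows "w = 0"
proof -
  let ?z = "\<lambda>l. unit_node (\<tau> l)"
  have z: "inj ?z"
    using comp_inj_on[OF assms(1) inj_on_subset[OF inj_on_unit_node assms(2)]] by (simp add: comp_def)
  have "w $ a = 0" for a
  proof -
    define r where "r = (\<Prod>l\<in>- {a}. [:- ?z l, 1:])"
    \<comment> \<open>Scaled so that the matrix sends the coefficients to \<open>w $ a\<close> at
      node \<open>a\<close>. The value \<open>w $ a\<close> rather than 1 makes the real inner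
      product with \<open>w\<close> equal to the squared modulus of \<open>w $ a\<close>.\<close>
    define p where "p = smult (w $ a * ?z a ^ q / poly r (?z a)) r"
    have ra: "poly r (?z a) \<noteq> 0" using z by (auto simp: r_def poly_prod dest: injD)
    have "degree r = (\<Sum>l\<in>- {a}. degree [:- ?z l, 1:])"
      unfolding r_def by (rule degree_prod_eq_sum_degree) simp
    then have "degree p \<le> 2 * q"
      using assms(3) card_frequencies by (auto simp: p_def Compl_eq_Diff_UNIV card_Diff_singleton)
    note f = fourier_matrix_mult_coeff_vec[OF this, of \<tau>]
    have "fourier_matrix \<kappa> \<tau> *v coeff_vec p = axis a (w $ a)"
    proof (rule vec_eq_iff[THEN iffD2, rule_format])
      fix l
      have "poly r (?z l) = 0" if "l \<noteq> a"
        using that by (auto simp: r_def poly_prod)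
      then show "(fourier_matrix \<kappa> \<tau> *v coeff_vec p) $ l = axis a (w $ a) $ l"
        using f[of l] ra by (cases "l = a") (simp_all add: p_def axis_def)
    qed
    then have "inner (axis a (w $ a)) w = 0"
      using inner_conj_transpose[of "fourier_matrix \<kappa> \<tau>" "coeff_vec p" w] w by simp
    then show ?thesis by (simp add: inner_axis')
  qed
  then show ?thesis by (simp add: vec_eq_iff)
qed

text \<open>Rows \<open>a\<close> and \<open>b\<close>, applied to column \<open>a\<close> of
  \<open>B\<close>, give 1 and 0, yet each entry differs between the two rows by at most
  \<open>2 * pi * q * D\<close>. So that column must be of size at least of order
  \<open>1 / D\<close>.\<close>

lemma one_le_right_inverse_column:
  fixes B :: "complex ^ 'm::finite ^ 'n"
  assumes B: "fourier_matrix \<kappa> \<tau> ** B = mat 1" and "a \<noteq> b" "\<bar>\<tau> b - \<tau> a\<bar> \<le> D"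
  shows "1 \<le> (real CARD('n) * (2 * pi * real q))\<^sup>2 * D\<^sup>2 * (norm (column a B))\<^sup>2"
proof -
  let ?A = "fourier_matrix \<kappa> \<tau>" and ?v = "column a B"
  have Av: "(?A *v ?v) $ l = (if l = a then 1 else 0)" for l
    using arg_cong[OF B, of "\<lambda>X. X $ l $ a"]
    by (simp add: matrix_matrix_mult_def matrix_vector_mult_def column_def mat_def)
  have "1 = norm ((?A *v ?v) $ a - (?A *v ?v) $ b)" using \<open>a \<noteq> b\<close> by (simp add: Av)
  also have "\<dots> = norm (\<Sum>k\<in>UNIV. (?A $ a $ k - ?A $ b $ k) * ?v $ k)"
    by (simp add: matrix_vector_mult_def sum_subtractf algebra_simps)
  also have "\<dots> \<le> (\<Sum>k\<in>(UNIV :: 'n set). (2 * pi * real q * D) * norm ?v)"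
  proof (rule sum_norm_le)
    fix k
    have "norm (?A $ a $ k - ?A $ b $ k) \<le> 2 * pi * \<bar>real_of_int (\<kappa> k)\<bar> * \<bar>\<tau> a - \<tau> b\<bar>"
      by (rule norm_fourier_matrix_diff_le)
    also have "\<dots> \<le> (2 * pi * real q) * D"
      using assms(3) abs_frequency_le[of k] by (intro mult_mono) auto
    finally have "norm (?A $ a $ k - ?A $ b $ k) \<le> 2 * pi * real q * D" .
    moreover have "0 \<le> D" using assms(3) by linarith
    ultimately show "norm ((?A $ a $ k - ?A $ b $ k) * ?v $ k) \<le> (2 * pi * real q * D) * norm ?v"
      unfolding norm_mult using Finite_Cartesian_Product.norm_nth_le[of ?v k] by (intro mult_mono) (auto intro: order_trans[rotated])
  qed
  also have "\<dots> = real CARD('n) * (2 * pi * real q) * D * norm ?v" by simp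
  finally have "1\<^sup>2 \<le> (real CARD('n) * (2 * pi * real q) * D * norm ?v)\<^sup>2"
    by (intro power_mono) auto
  then show ?thesis by (simp add: power_mult_distrib)
qed

text \<open>The power of \<open>z - z_a\<close> of the largest admissible degree
  \<open>2 * q\<close> has values of order \<open>D ^ (2 * q)\<close> at all nodes, while its
  coefficient vector has norm at least 1. Since \<open>B\<close> recovers the coefficients from the
  values, it must be large; squaring produces the exponent \<open>4 * q\<close>.\<close>

lemma one_le_left_inverse_columns:
  fixes B :: "complex ^ 'm::finite ^ 'n"
  assumes B: "B ** fourier_matrix \<kappa> \<tau> = mat 1" and D: "\<And>l. \<bar>\<tau> l - \<tau> a\<bar> \<le> D"
  shows "1 \<le> (real CARD('m))\<^sup>2 * (2 * pi) ^ (4 * q) * D ^ (4 * q) * (\<Sum>l\<in>UNIV. (norm (column l B))\<^sup>2)"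
proof -
  let ?A = "fourier_matrix \<kappa> \<tau>" and ?z = "\<lambda>l. unit_node (\<tau> l)"
  define p where "p = [:- ?z a, 1:] ^ (2 * q)"
  define v where "v = coeff_vec p"
  have deg: "degree p = 2 * q" by (simp add: p_def degree_power_eq)
  have "2 * q \<in> range shifted" using bij_shifted by (auto simp: bij_betw_def)
  then obtain k where k: "shifted k = 2 * q" by auto
  \<comment> \<open>The leading coefficient 1 is an entry of \<open>v\<close>, which bounds its norm
    from below without computing the other coefficients.\<close>
  have "lead_coeff p = 1" by (simp add: p_def lead_coeff_power)
  then have "v $ k = 1" using k deg by (simp add: v_def coeff_vec_def)
  then have "1 \<le> norm v" using Finite_Cartesian_Product.norm_nth_le[of v k] by simp
  have Av: "norm ((?A *v v) $ l) \<le> (2 * pi * D) ^ (2 * q)" for l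
  proof -
    have "norm ((?A *v v) $ l) = norm (unit_node (\<tau> l) ^ q * (?A *v v) $ l)"
      by (simp add: norm_mult norm_power)
    also have "\<dots> = norm (?z l - ?z a) ^ (2 * q)"
      using fourier_matrix_mult_coeff_vec[of p \<tau> l] deg by (simp add: v_def p_def norm_power)
    also have "\<dots> \<le> (2 * pi * D) ^ (2 * q)"
      using norm_unit_node_diff_le[of "\<tau> l" "\<tau> a"] D[of l]
      by (intro power_mono) (auto intro: order_trans)
    finally show ?thesis .
  qed
  have "(norm (?A *v v))\<^sup>2 = (\<Sum>l\<in>UNIV. (norm ((?A *v v) $ l))\<^sup>2)"
    by (simp add: norm_vec_def L2_set_def sum_nonneg)
  also have "\<dots> \<le> (\<Sum>l\<in>(UNIV :: 'm set). ((2 * pi * D) ^ (2 * q))\<^sup>2)"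
    by (intro sum_mono power_mono Av) simp
  also have "\<dots> = real CARD('m) * (2 * pi * D) ^ (4 * q)"
    by (simp add: power_mult[symmetric] mult_ac)
  finally have nAv: "(norm (?A *v v))\<^sup>2 \<le> real CARD('m) * (2 * pi * D) ^ (4 * q)" .
  have "1 \<le> (norm v)\<^sup>2" using \<open>1 \<le> norm v\<close> by simp
  also have "(norm v)\<^sup>2 = (norm (B *v (?A *v v)))\<^sup>2"
    by (simp add: matrix_vector_mul_assoc B)
  also have "\<dots> \<le> (norm (?A *v v))\<^sup>2 * (real CARD('m) * (\<Sum>l\<in>UNIV. (norm (column l B))\<^sup>2))"
    by (rule norm_mult_vec_le_columns)
  also have "\<dots> \<le> (real CARD('m) * (2 * pi * D) ^ (4 * q)) * (real CARD('m) * (\<Sum>l\<in>UNIV. (norm (column l B))\<^sup>2))"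
    using nAv by (intro mult_right_mono) (auto simp: sum_nonneg)
  also have "\<dots> = (real CARD('m))\<^sup>2 * (2 * pi) ^ (4 * q) * D ^ (4 * q) * (\<Sum>l\<in>UNIV. (norm (column l B))\<^sup>2)"
    by (simp add: power_mult_distrib power2_eq_square)
  finally show ?thesis .
qed

lemma full_rank_pinv_fourier:
  fixes \<tau> :: "'m::finite \<Rightarrow> real"
  assumes "inj \<tau>" "range \<tau> \<subseteq> {0..<1}"
  shows "is_moore_penrose_inverse (fourier_matrix \<kappa> \<tau>) (full_rank_pinv (fourier_matrix \<kappa> \<tau>))"
    and "CARD('m) \<le> CARD('n) \<Longrightarrow> fourier_matrix \<kappa> \<tau> ** full_rank_pinv (fourier_matrix \<kappa> \<tau>) = mat 1"
    and "CARD('n) < CARD('m) \<Longrightarrow> full_rank_pinv (fourier_matrix \<kappa> \<tau>) ** fourier_matrix \<kappa> \<tau> = mat 1"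
proof -
  note inj = fourier_matrix_injective[OF assms] and adj = fourier_matrix_adjoint_injective[OF assms]
  show "is_moore_penrose_inverse (fourier_matrix \<kappa> \<tau>) (full_rank_pinv (fourier_matrix \<kappa> \<tau>))"
  proof (cases "CARD('m) \<le> CARD('n)")
    case True
    then show ?thesis by (intro full_rank_pinv_right adj)
  next
    case False
    then show ?thesis by (intro full_rank_pinv_left inj) auto
  qed
  show "fourier_matrix \<kappa> \<tau> ** full_rank_pinv (fourier_matrix \<kappa> \<tau>) = mat 1" if "CARD('m) \<le> CARD('n)"
    using that by (auto intro!: full_rank_pinv_right adj)
  show "full_rank_pinv (fourier_matrix \<kappa> \<tau>) ** fourier_matrix \<kappa> \<tau> = mat 1" if "CARD('n) < CARD('m)"
    using that by (auto intro!: full_rank_pinv_left inj)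
qed

text \<open>A cluster of diameter \<open>D\<close> around node \<open>a\<close> has probability of order \<open>D ^ card J\<close>, which is
  exactly cancelled by the lower bound on the pseudoinverse. Two close rows suffice if
  \<open>m \<le> N\<close>; otherwise the polynomial \<open>(z - z\<^sub>a) ^ (N - 1)\<close> is small on a cluster of all nodes.\<close>

lemma clustered_nodes_bound:
  assumes "2 \<le> CARD('m::finite)" "CARD('m::finite) < 2 * CARD('n)"
  obtains a :: "'m::finite" and J C where "J \<noteq> {}" "a \<notin> J" "C > 0"
    "\<forall>(\<tau> :: 'm::finite \<Rightarrow> real) D. inj \<tau> \<and> range \<tau> \<subseteq> {0..<1} \<and> 0 \<le> D \<and> D \<le> 1 \<and>
       (\<forall>j\<in>J. \<bar>\<tau> j - \<tau> a\<bar> \<le> D) \<longrightarrow>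
       1 \<le> C * D ^ card J * (\<Sum>l\<in>UNIV. (norm (column l (full_rank_pinv (fourier_matrix \<kappa> \<tau>))))\<^sup>2)"
proof -
  obtain a b :: 'm where ab: "a \<noteq> b"
  proof (rule ccontr)
    assume "\<not> thesis"
    then have "(UNIV :: 'm set) = {undefined}" using that by auto
    from arg_cong[OF this, of card] show False using assms(1) by simp
  qed
  let ?F = "\<lambda>\<tau>. \<Sum>l\<in>UNIV. (norm (column l (full_rank_pinv (fourier_matrix \<kappa> \<tau>) :: complex ^ 'm ^ 'n)))\<^sup>2"
  have F0: "?F \<tau> \<ge> 0" for \<tau> by (simp add: sum_nonneg)
  show thesis
  proof (cases "CARD('m) \<le> CARD('n)")
    case True
    let ?C = "(real CARD('n) * (2 * pi * real q))\<^sup>2"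
    show thesis
    \<comment> \<open>\<open>?C\<close> vanishes for \<open>q = 0\<close>, which the locale permits;
      adding 1 keeps the constant positive.\<close>
    proof (rule that[of "{b}" a "?C + 1"]; (intro allI impI)?)
      fix \<tau> :: "'m \<Rightarrow> real" and D :: real
      assume *: "inj \<tau> \<and> range \<tau> \<subseteq> {0..<1} \<and> 0 \<le> D \<and> D \<le> 1 \<and> (\<forall>j\<in>{b}. \<bar>\<tau> j - \<tau> a\<bar> \<le> D)"
      then have \<tau>: "inj \<tau>" "range \<tau> \<subseteq> {0..<1}" by auto
      have D: "0 \<le> D" "D \<le> 1" "\<And>j. j \<in> {b} \<Longrightarrow> \<bar>\<tau> j - \<tau> a\<bar> \<le> D"
        using * by auto
      let ?B = "full_rank_pinv (fourier_matrix \<kappa> \<tau>)"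
      have "1 \<le> ?C * D\<^sup>2 * (norm (column a ?B))\<^sup>2"
        using one_le_right_inverse_column[OF full_rank_pinv_fourier(2)[OF \<tau>(1,2) True] ab D(3)] by simp
      also have "\<dots> \<le> (?C + 1) * D * ?F \<tau>"
      proof (intro mult_mono)
        \<comment> \<open>The estimate offers \<open>D ^ 2\<close>, whereas
          \<open>card {b} = 1\<close> asks only for \<open>D\<close>.\<close>
        show "D\<^sup>2 \<le> D" using D by (simp add: power2_eq_square mult_left_le)
        show "(norm (column a ?B))\<^sup>2 \<le> ?F \<tau>"
          by (rule member_le_sum) auto
      qed (use D F0 in auto)
      finally show "1 \<le> (?C + 1) * D ^ card {b} * ?F \<tau>" by simp
    qed (use ab in \<open>auto intro: add_nonneg_pos\<close>)
  next
    case False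
    let ?C = "(real CARD('m))\<^sup>2 * (2 * pi) ^ (4 * q)"
    show thesis
    proof (rule that[of "- {a}" a ?C]; (intro allI impI)?)
      fix \<tau> :: "'m \<Rightarrow> real" and D :: real
      assume *: "inj \<tau> \<and> range \<tau> \<subseteq> {0..<1} \<and> 0 \<le> D \<and> D \<le> 1 \<and> (\<forall>j\<in>- {a}. \<bar>\<tau> j - \<tau> a\<bar> \<le> D)"
      then have \<tau>: "inj \<tau>" "range \<tau> \<subseteq> {0..<1}" by auto
      have D: "0 \<le> D" "D \<le> 1" "\<And>j. j \<in> - {a} \<Longrightarrow> \<bar>\<tau> j - \<tau> a\<bar> \<le> D"
        using * by auto
      have D': "\<bar>\<tau> l - \<tau> a\<bar> \<le> D" for l using D(1) D(3)[of l] by (cases "l = a") auto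
      have "1 \<le> ?C * D ^ (4 * q) * ?F \<tau>"
        using one_le_left_inverse_columns[OF full_rank_pinv_fourier(3)[OF \<tau>] D'] False by simp
      also have "\<dots> \<le> ?C * D ^ card (- {a}) * ?F \<tau>"
      proof (intro mult_right_mono mult_left_mono power_decreasing)
        \<comment> \<open>Here \<open>m < 2 * N\<close> enters:
          \<open>m - 1 <= 2 * N - 2 = 4 * q\<close>.\<close>
        show "card (- {a}) \<le> 4 * q"
          using assms(2) card_frequencies by (simp add: Compl_eq_Diff_UNIV card_Diff_singleton)
      qed (use D F0 in auto)
      finally show "1 \<le> ?C * D ^ card (- {a}) * ?F \<tau>" .
    qed (use ab in auto)
  qed
qed

end

section \<open>Clusters of uniform nodes\<close>

locale uniform_nodes = prob_space M for M :: "'a measure" +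
  fixes t :: "'m::finite \<Rightarrow> 'a \<Rightarrow> real"
  assumes indep: "indep_vars (\<lambda>_. borel) t UNIV"
    and uniform: "\<And>l. distr M borel (t l) = uniform_measure lborel {0..<1}"
begin

lemma measurable_node [measurable]: "t l \<in> borel_measurable M"
  using indep by (auto simp: indep_vars_def)

lemma prob_node_interval:
  assumes "0 \<le> u" "u \<le> v" "v \<le> 1"
  shows "prob (t l -` {u..<v} \<inter> space M) = v - u"
proof -
  have "emeasure M (t l -` {u..<v} \<inter> space M) = emeasure (distr M borel (t l)) {u..<v}"
    by (simp add: emeasure_distr)
  also have "\<dots> = emeasure lborel ({0..<1} \<inter> {u..<v})"
    by (simp add: uniform divide_ennreal_def)
  also have "{0..<1} \<inter> {u..<v} = {u..<v}" using assms by auto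
  finally show ?thesis using assms by (simp add: measure_def)
qed

lemma prob_node_box:
  assumes "K \<noteq> {}" "\<And>l. l \<in> K \<Longrightarrow> 0 \<le> u l \<and> u l \<le> v l \<and> v l \<le> 1"
  shows "prob {\<omega> \<in> space M. \<forall>l\<in>K. t l \<omega> \<in> {u l..<v l}} = (\<Prod>l\<in>K. v l - u l)"
proof -
  have "{\<omega> \<in> space M. \<forall>l\<in>K. t l \<omega> \<in> {u l..<v l}} = (\<Inter>l\<in>K. t l -` {u l..<v l} \<inter> space M)"
    using assms(1) by auto
  also have "prob \<dots> = (\<Prod>l\<in>K. prob (t l -` {u l..<v l} \<inter> space M))"
    using assms(1) by (intro indep_varsD_finite[OF indep_vars_subset[OF indep]]) auto
  also have "\<dots> = (\<Prod>l\<in>K. v l - u l)"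
    using assms(2) by (intro prod.cong refl prob_node_interval) auto
  finally show ?thesis .
qed

lemma AE_nodes_in_interval: "AE \<omega> in M. range (\<lambda>l. t l \<omega>) \<subseteq> {0..<1}"
proof -
  have "AE \<omega> in M. t l \<omega> \<in> {0..<1}" for l
  proof -
    have "prob {\<omega> \<in> space M. t l \<omega> \<in> {0..<1}} = 1"
      using prob_node_box[of "{l}" "\<lambda>_. 0" "\<lambda>_. 1"] by simp
    then show ?thesis by (subst (asm) prob_Collect_eq_1) auto
  qed
  then have "AE \<omega> in M. \<forall>l. t l \<omega> \<in> {0..<1}" by (simp add: AE_all_countable)
  then show ?thesis by (auto elim!: eventually_mono)
qed

text \<open>Coinciding nodes share one of \<open>n + 1\<close> grid cells of width
  \<open>h = 1 / (n + 1)\<close>. Each cell contains both with probability \<open>h * h\<close>, so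
  the total is at most \<open>h\<close>, which tends to zero.\<close>

lemma AE_nodes_distinct: "AE \<omega> in M. inj (\<lambda>l. t l \<omega>)"
proof -
  have "AE \<omega> in M. t a \<omega> \<noteq> t b \<omega>" if "a \<noteq> b" for a b
  proof -
    let ?E = "{\<omega> \<in> space M. t a \<omega> = t b \<omega> \<and> t a \<omega> \<in> {0..<1}}"
    have "prob ?E \<le> 1 / real (Suc n)" for n
    proof -
      define h where "h = 1 / real (Suc n)"
      have h: "h > 0" "real (Suc n) * h = 1" by (simp_all add: h_def)
      let ?F = "\<lambda>k. {\<omega> \<in> space M. \<forall>l\<in>{a, b}. t l \<omega> \<in> {real k * h..<(real k + 1) * h}}"
      have "?E \<subseteq> (\<Union>k<Suc n. ?F k)"
      proof
        fix \<omega> assume w: "\<omega> \<in> ?E"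
        define k where "k = nat \<lfloor>t a \<omega> / h\<rfloor>"
        have "0 \<le> t a \<omega> / h" using w h by simp
        then have "real k \<le> t a \<omega> / h" "t a \<omega> / h < real k + 1"
          unfolding k_def by linarith+
        then have k: "real k * h \<le> t a \<omega>" "t a \<omega> < (real k + 1) * h"
          using h(1) by (simp_all add: field_simps)
        have "real k * h < real (Suc n) * h" using k(1) w h(2) by auto
        then have "k < Suc n" using h(1) by simp
        then show "\<omega> \<in> (\<Union>k<Suc n. ?F k)" using k w by auto
      qed
      then have "prob ?E \<le> prob (\<Union>k<Suc n. ?F k)"
        by (intro finite_measure_mono) auto
      also have "\<dots> \<le> (\<Sum>k<Suc n. prob (?F k))"
        by (intro finite_measure_subadditive_finite) auto
      also have "\<dots> = (\<Sum>k<Suc n. h * h)"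
      proof (intro sum.cong refl)
        fix k assume k: "k \<in> {..<Suc n}"
        have "(real k + 1) * h \<le> real (Suc n) * h"
          using k h by (intro mult_right_mono) auto
        then have "(real k + 1) * h \<le> 1" using h(2) by linarith
        then have "prob (?F k) = (\<Prod>l\<in>{a, b}. (real k + 1) * h - real k * h)"
          using h by (intro prob_node_box) (auto intro: mult_right_mono)
        then show "prob (?F k) = h * h"
          using \<open>a \<noteq> b\<close> by (simp add: algebra_simps)
      qed
      also have "\<dots> = (real (Suc n) * h) * h" by simp
      finally show ?thesis by (simp only: h(2) h_def) simp
    qed
    then have "prob ?E \<le> 0"
      by (intro LIMSEQ_le_const[OF LIMSEQ_Suc[OF lim_1_over_n]]) auto
    then have "AE \<omega> in M. \<not> (t a \<omega> = t b \<omega> \<and> t a \<omega> \<in> {0..<1})"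
      by (subst prob_Collect_eq_0[symmetric]) (auto intro: antisym)
    then show ?thesis using AE_nodes_in_interval
    proof eventually_elim
      case (elim \<omega>)
      then show ?case using range_subsetD[OF elim(2), of a] by auto
    qed
  qed
  then have "AE \<omega> in M. \<forall>a b. a \<noteq> b \<longrightarrow> t a \<omega> \<noteq> t b \<omega>"
    by (simp add: AE_all_countable)
  then show ?thesis by (auto simp: inj_def elim!: eventually_mono)
qed

text \<open>The nodes in \<open>J\<close> lie in a grid cell of width \<open>4 ^ - n\<close> two cells to the right of the cell
  of node \<open>a\<close>, so that their distances to \<open>t a\<close> lie in an interval \<open>(4 ^ - n, 3 * 4 ^ - n)\<close>; these
  intervals are disjoint for different \<open>n\<close>.\<close>

definition cluster :: "'m \<Rightarrow> 'm set \<Rightarrow> nat \<Rightarrow> 'a set" where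
  "cluster a J n = (\<Union>i<4 ^ n - 2. {\<omega> \<in> space M. \<forall>l\<in>insert a J.
     t l \<omega> \<in> {(real i + (if l = a then 0 else 2)) * (1 / 4) ^ n..<(real i + (if l = a then 1 else 3)) * (1 / 4) ^ n}})"

lemma sets_cluster [measurable]: "cluster a J n \<in> events"
  unfolding cluster_def by measurable

lemma cluster_distance:
  assumes "\<omega> \<in> cluster a J n" "j \<in> J" "a \<notin> J"
  shows "(1 / 4) ^ n < t j \<omega> - t a \<omega>" "t j \<omega> - t a \<omega> < 3 * (1 / 4) ^ n"
proof -
  obtain i :: nat where i: "\<forall>l\<in>insert a J. t l \<omega> \<in>
      {(real i + (if l = a then 0 else 2)) * (1 / 4) ^ n..<(real i + (if l = a then 1 else 3)) * (1 / 4) ^ n}"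
    using assms(1) unfolding cluster_def by blast
  have "j \<noteq> a" using assms by auto
  then show "(1 / 4) ^ n < t j \<omega> - t a \<omega>" "t j \<omega> - t a \<omega> < 3 * (1 / 4) ^ n"
    using bspec[OF i, of j] bspec[OF i, of a] assms(2) by (simp_all add: distrib_right)
qed

text \<open>For \<open>m < n\<close> the upper distance bound \<open>3 * 4 ^ - n\<close> at level
  \<open>n\<close> is below the lower bound \<open>4 ^ - m\<close> at level
  \<open>m\<close>.\<close>

lemma cluster_disjoint:
  assumes "a \<notin> J" "J \<noteq> {}" "m \<noteq> n"
  shows "cluster a J m \<inter> cluster a J n = {}"
proof -
  have "False" if "\<omega> \<in> cluster a J m" "\<omega> \<in> cluster a J n" "m < n" for \<omega> m n
  proof -
    obtain j where j: "j \<in> J" using assms by auto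
    have "(1 / 4 :: real) ^ n \<le> (1 / 4) ^ Suc m"
      using that(3) by (intro power_decreasing) auto
    then show False
      using cluster_distance[OF that(1) j assms(1)] cluster_distance[OF that(2) j assms(1)] by simp
  qed
  then show ?thesis using \<open>m \<noteq> n\<close> by (metis disjoint_iff linorder_neqE_nat)
qed

text \<open>With \<open>h = 4 ^ - n\<close> there are \<open>4 ^ n - 2\<close> disjoint boxes of
  probability \<open>h ^ (card J + 1)\<close>. After scaling this leaves \<open>1 - 2 * h\<close>,
  and \<open>h <= 1 / 4\<close>.\<close>

lemma prob_cluster_ge:
  assumes "a \<notin> J" "n \<ge> 1"
  shows "1 / 2 \<le> 4 ^ (n * card J) * prob (cluster a J n)"
proof -
  define h :: real where "h = (1 / 4) ^ n"
  let ?k = "4 ^ n - 2 :: nat"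
  let ?F = "\<lambda>i. {\<omega> \<in> space M. \<forall>l\<in>insert a J.
     t l \<omega> \<in> {(real i + (if l = a then 0 else 2)) * h..<(real i + (if l = a then 1 else 3)) * h}}"
  have h: "h > 0" "4 ^ n * h = 1" by (simp_all add: h_def power_one_over)
  \<comment> \<open>For \<open>n >= 1\<close> the truncated subtraction in \<open>?k\<close> agrees
    with the real one.\<close>
  have "(4 :: nat) ^ 1 \<le> 4 ^ n" using assms(2) by (intro power_increasing) auto
  then have four: "(4 :: nat) \<le> 4 ^ n" by simp
  have k: "real ?k = 4 ^ n - 2" using four by (simp add: of_nat_diff)
  have F: "prob (?F i) = h ^ (card J + 1)" if "i < ?k" for i
  proof -
    \<comment> \<open>The range of \<open>i\<close> is two short of \<open>4 ^ n\<close> so that the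
      shifted cell, ending at \<open>(i + 3) * h\<close>, stays inside the unit interval.\<close>
    have "real i + 1 \<le> real ?k" using that by linarith
    then have "(real i + 3) * h \<le> 4 ^ n * h"
      using k h by (intro mult_right_mono) auto
    moreover have "(real i + 1) * h \<le> (real i + 3) * h" using h by simp
    ultimately have "(real i + 3) * h \<le> 1" "(real i + 1) * h \<le> 1" using h by linarith+
    then have "prob (?F i) = (\<Prod>l\<in>insert a J. (real i + (if l = a then 1 else 3)) * h - (real i + (if l = a then 0 else 2)) * h)"
      using h by (intro prob_node_box) (auto intro!: mult_right_mono)
    also have "\<dots> = (\<Prod>l\<in>insert a J. h)" by (intro prod.cong) (auto simp: algebra_simps)
    finally show ?thesis using assms(1) by simp
  qed
  have disj: "disjoint_family_on ?F {..<?k}"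
  proof -
    have "False" if "\<omega> \<in> ?F i" "\<omega> \<in> ?F j" "i < j" for \<omega> i j
    proof -
      have "(real i + 1) * h \<le> real j * h" using that(3) h by (intro mult_right_mono) auto
      then show False using that(1,2) by auto
    qed
    then show ?thesis
      unfolding disjoint_family_on_def by (metis (no_types, lifting) disjoint_iff linorder_neqE_nat)
  qed
  have "prob (cluster a J n) = (\<Sum>i<?k. prob (?F i))"
    unfolding cluster_def h_def[symmetric]
    by (rule finite_measure_finite_Union[OF _ _ disj]) auto
  also have "\<dots> = real ?k * h ^ (card J + 1)" using F by simp
  finally have "4 ^ (n * card J) * prob (cluster a J n) = real ?k * h * (4 ^ n * h) ^ card J"
    by (simp add: power_mult power_mult_distrib)
  also have "\<dots> = (4 ^ n - 2) * h" using h k by simp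
  also have "\<dots> \<ge> 1 / 2"
  proof -
    have "(4 :: real) \<le> 4 ^ n" using four by (metis of_nat_le_iff of_nat_numeral of_nat_power)
    then have "4 * h \<le> 1" using h by (metis mult_right_mono less_imp_le)
    then show ?thesis using h by (simp add: algebra_simps)
  qed
  finally show ?thesis .
qed

text \<open>Growth of \<open>f\<close> on level \<open>n\<close> compensates the probability of that
  level, so each of infinitely many disjoint levels contributes at least
  \<open>1 / 2\<close>.\<close>

lemma nn_integral_cluster_infinite:
  fixes f :: "'a \<Rightarrow> ennreal"
  assumes "a \<notin> J" "J \<noteq> {}"
    and f: "AE \<omega> in M. \<forall>n\<ge>1. \<omega> \<in> cluster a J n \<longrightarrow> ennreal (4 ^ (n * card J)) \<le> f \<omega>"
  shows "(\<integral>\<^sup>+\<omega>. f \<omega> \<partial>M) = \<infinity>"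
proof -
  \<comment> \<open>The index is \<open>Suc n\<close> since level 0 is empty.\<close>
  let ?g = "\<lambda>n \<omega>. ennreal (4 ^ (Suc n * card J)) * indicator (cluster a J (Suc n)) \<omega>"
  have "\<infinity> = (\<Sum>n::nat. ennreal (1 / 2))"
    by (subst nn_integral_count_space_nat[symmetric]) (simp add: ennreal_mult_eq_top_iff)
  also have "\<dots> \<le> (\<Sum>n. \<integral>\<^sup>+\<omega>. ?g n \<omega> \<partial>M)"
  proof (intro suminf_le summableI)
    fix n
    have "(\<integral>\<^sup>+\<omega>. ?g n \<omega> \<partial>M) = ennreal (4 ^ (Suc n * card J) * prob (cluster a J (Suc n)))"
      by (simp add: nn_integral_cmult_indicator emeasure_eq_measure ennreal_mult)
    then show "ennreal (1 / 2) \<le> (\<integral>\<^sup>+\<omega>. ?g n \<omega> \<partial>M)"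
      using ennreal_leI[OF prob_cluster_ge[OF assms(1), of "Suc n"]] by (simp only: One_nat_def Suc_le_mono zero_le)
  qed
  also have "\<dots> = (\<integral>\<^sup>+\<omega>. (\<Sum>n. ?g n \<omega>) \<partial>M)"
    by (rule nn_integral_suminf[symmetric]) measurable
  also have "\<dots> \<le> (\<integral>\<^sup>+\<omega>. f \<omega> \<partial>M)"
  proof (rule nn_integral_mono_AE, use f in eventually_elim)
    case (elim \<omega>)
    \<comment> \<open>At most one summand is nonzero at a given point, and \<open>f\<close>
      dominates it.\<close>
    show ?case
    proof (cases "\<exists>n. \<omega> \<in> cluster a J (Suc n)")
      case True
      then obtain n where n: "\<omega> \<in> cluster a J (Suc n)" by blast
      then have "\<omega> \<notin> cluster a J (Suc k)" if "k \<noteq> n" for k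
        using cluster_disjoint[OF assms(1,2), of "Suc k" "Suc n"] that by auto
      then have "(\<Sum>k. ?g k \<omega>) = (\<Sum>k\<in>{n}. ?g k \<omega>)"
        by (intro suminf_finite) auto
      also have "\<dots> \<le> f \<omega>" using n elim by (auto simp del: power_Suc mult_Suc)
      finally show ?thesis .
    qed auto
  qed
  finally show ?thesis by (simp add: top.extremum_unique)
qed

end

section \<open>Independence and reflected noise\<close>

lemma (in prob_space) indep_three_emeasure:
  assumes I: "indep_three N1 X1 N2 X2 N3 X3" and A: "A \<in> sets N1" "B \<in> sets N2" "C \<in> sets N3"
  shows "emeasure M ((X1 -` A \<inter> space M) \<inter> (X2 -` B \<inter> space M) \<inter> (X3 -` C \<inter> space M))
    = emeasure M (X1 -` A \<inter> space M) * emeasure M (X2 -` B \<inter> space M) * emeasure M (X3 -` C \<inter> space M)"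
proof -
  define S where "S i = (if i = 1 then X1 -` A \<inter> space M else if i = 2 then X2 -` B \<inter> space M
     else X3 -` C \<inter> space M)" for i :: nat
  have "prob (\<Inter>i\<in>{1::nat, 2, 3}. S i) = (\<Prod>i\<in>{1::nat, 2, 3}. prob (S i))"
    by (rule indep_setsD[OF conjunct2[OF conjunct2[OF conjunct2[OF I[unfolded indep_three_def]]]]])
      (use A in \<open>auto simp: S_def\<close>)
  also have "(\<Inter>i\<in>{1::nat, 2, 3}. S i) = (X1 -` A \<inter> space M) \<inter> (X2 -` B \<inter> space M) \<inter> (X3 -` C \<inter> space M)"
    by (auto simp: S_def)
  also have "(\<Prod>i\<in>{1::nat, 2, 3}. prob (S i)) =
      prob (X1 -` A \<inter> space M) * prob (X2 -` B \<inter> space M) * prob (X3 -` C \<inter> space M)"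
    by (simp add: S_def)
  finally show ?thesis
    by (simp add: emeasure_eq_measure ennreal_mult)
qed

text \<open>A product measure is identified by its values on products of two sets, so this is done
  twice: first for \<open>B \<times> C\<close> with \<open>A\<close> fixed, then for
  \<open>A \<times> E\<close> with \<open>E\<close> any measurable set of pairs.\<close>

lemma (in prob_space) indep_three_distr:
  assumes I: "indep_three N1 X1 N2 X2 N3 X3"
  shows "distr M (N1 \<Otimes>\<^sub>M (N2 \<Otimes>\<^sub>M N3)) (\<lambda>\<omega>. (X1 \<omega>, X2 \<omega>, X3 \<omega>)) =
    distr M N1 X1 \<Otimes>\<^sub>M (distr M N2 X2 \<Otimes>\<^sub>M distr M N3 X3)"
proof -
  have [measurable]: "random_variable N1 X1" "random_variable N2 X2" "random_variable N3 X3"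
    using I by (auto simp: indep_three_def)
  let ?D1 = "distr M N1 X1" and ?D2 = "distr M N2 X2" and ?D3 = "distr M N3 X3"
  interpret D1: prob_space ?D1 by (rule prob_space_distr) simp
  interpret D2: prob_space ?D2 by (rule prob_space_distr) simp
  interpret D3: prob_space ?D3 by (rule prob_space_distr) simp
  interpret D23: pair_prob_space ?D2 ?D3 ..
  show ?thesis
  proof (rule pair_measure_eqI[symmetric])
    show "sigma_finite_measure ?D1" "sigma_finite_measure (?D2 \<Otimes>\<^sub>M ?D3)" by unfold_locales
    show "sets (?D1 \<Otimes>\<^sub>M (?D2 \<Otimes>\<^sub>M ?D3)) =
        sets (distr M (N1 \<Otimes>\<^sub>M (N2 \<Otimes>\<^sub>M N3)) (\<lambda>\<omega>. (X1 \<omega>, X2 \<omega>, X3 \<omega>)))"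
      by (simp cong: sets_pair_measure_cong)
    fix A E assume A: "A \<in> sets ?D1" and E: "E \<in> sets (?D2 \<Otimes>\<^sub>M ?D3)"
    have [measurable]: "A \<in> sets N1" "E \<in> sets (N2 \<Otimes>\<^sub>M N3)"
      using A E by (simp_all cong: sets_pair_measure_cong)
    define c where "c = emeasure M (X1 -` A \<inter> space M)"
    have c: "c \<noteq> \<infinity>" by (simp add: c_def)
    \<comment> \<open>The joint law of \<open>X2\<close> and \<open>X3\<close> on the event that
      \<open>X1\<close> lies in \<open>A\<close>. It is compared with the product of the laws of
      \<open>X2\<close> and \<open>X3\<close>, the former scaled by the probability \<open>c\<close>
      of that event.\<close>
    let ?K = "distr (density M (indicator (X1 -` A \<inter> space M))) (N2 \<Otimes>\<^sub>M N3) (\<lambda>\<omega>. (X2 \<omega>, X3 \<omega>))"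
    let ?L = "density ?D2 (\<lambda>_. c)"
    have K: "emeasure ?K E' = emeasure M ((X1 -` A \<inter> space M) \<inter> ((\<lambda>\<omega>. (X2 \<omega>, X3 \<omega>)) -` E' \<inter> space M))"
      if [measurable]: "E' \<in> sets (N2 \<Otimes>\<^sub>M N3)" for E'
      by (simp add: emeasure_distr emeasure_density nn_integral_indicator flip: indicator_inter_arith)
    have "?L \<Otimes>\<^sub>M ?D3 = ?K"
    proof (rule pair_measure_eqI)
      have "emeasure ?L (space ?D2) = c"
        using D2.emeasure_space_1 by (subst emeasure_density_const) auto
      then have "finite_measure ?L"
        using c by (intro finite_measureI) simp
      then show "sigma_finite_measure ?L" by (rule finite_measure.sigma_finite_measure)
      show "sigma_finite_measure ?D3" by unfold_locales
      show "sets (?L \<Otimes>\<^sub>M ?D3) = sets ?K" by (simp cong: sets_pair_measure_cong)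
      fix B C assume BC: "B \<in> sets ?L" "C \<in> sets ?D3"
      then have [measurable]: "B \<in> sets N2" "C \<in> sets N3" by simp_all
      have "emeasure ?K (B \<times> C) =
          emeasure M ((X1 -` A \<inter> space M) \<inter> (X2 -` B \<inter> space M) \<inter> (X3 -` C \<inter> space M))"
        by (subst K) (auto intro!: arg_cong[where f = "emeasure M"])
      also have "\<dots> = c * emeasure M (X2 -` B \<inter> space M) * emeasure M (X3 -` C \<inter> space M)"
        unfolding c_def by (rule indep_three_emeasure[OF I]) auto
      finally show "emeasure ?L B * emeasure ?D3 C = emeasure ?K (B \<times> C)"
        by (simp add: emeasure_density_const emeasure_distr)
    qed
    then have "emeasure ?K E = emeasure (?L \<Otimes>\<^sub>M ?D3) E" by simp
    also have "\<dots> = c * emeasure (?D2 \<Otimes>\<^sub>M ?D3) E"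
    proof -
      have "emeasure (?L \<Otimes>\<^sub>M ?D3) E = (\<integral>\<^sup>+ x. emeasure ?D3 (Pair x -` E) \<partial>?L)"
        by (rule D3.emeasure_pair_measure_alt) (simp cong: sets_pair_measure_cong)
      also have "\<dots> = c * (\<integral>\<^sup>+ x. emeasure ?D3 (Pair x -` E) \<partial>?D2)"
        using D3.measurable_emeasure_Pair[OF E] by (simp add: nn_integral_density nn_integral_cmult)
      also have "\<dots> = c * emeasure (?D2 \<Otimes>\<^sub>M ?D3) E"
        by (simp only: D3.emeasure_pair_measure_alt[OF E])
      finally show ?thesis .
    qed
    finally have "c * emeasure (?D2 \<Otimes>\<^sub>M ?D3) E =
        emeasure M ((X1 -` A \<inter> space M) \<inter> ((\<lambda>\<omega>. (X2 \<omega>, X3 \<omega>)) -` E \<inter> space M))"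
      by (simp add: K)
    also have "\<dots> = emeasure (distr M (N1 \<Otimes>\<^sub>M (N2 \<Otimes>\<^sub>M N3)) (\<lambda>\<omega>. (X1 \<omega>, X2 \<omega>, X3 \<omega>))) (A \<times> E)"
      by (subst emeasure_distr) (auto intro!: arg_cong[where f = "emeasure M"])
    finally show "emeasure ?D1 A * emeasure (?D2 \<Otimes>\<^sub>M ?D3) E =
        emeasure (distr M (N1 \<Otimes>\<^sub>M (N2 \<Otimes>\<^sub>M N3)) (\<lambda>\<omega>. (X1 \<omega>, X2 \<omega>, X3 \<omega>))) (A \<times> E)"
      by (simp add: c_def emeasure_distr)
  qed
qed

lemma (in prob_space) indep_three_compose:
  assumes I: "indep_three N1 X1 N2 X2 N3 X3" and f: "f \<in> N2 \<rightarrow>\<^sub>M N2'"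
  shows "indep_three N1 X1 N2' (\<lambda>\<omega>. f (X2 \<omega>)) N3 X3"
proof -
  have X2: "random_variable N2 X2" using I by (simp add: indep_three_def)
  have pre: "(\<lambda>\<omega>. f (X2 \<omega>)) -` S \<inter> space M = X2 -` (f -` S \<inter> space N2) \<inter> space M" for S
    using measurable_space[OF X2] by auto
  have sub: "{(\<lambda>\<omega>. f (X2 \<omega>)) -` S \<inter> space M |S. S \<in> sets N2'} \<subseteq> {X2 -` S \<inter> space M |S. S \<in> sets N2}"
    unfolding pre using measurable_sets[OF f] by blast
  have *: "indep_sets (\<lambda>i. if i = 1 then {X1 -` S \<inter> space M |S. S \<in> sets N1}
      else if i = 2 then {(\<lambda>\<omega>. f (X2 \<omega>)) -` S \<inter> space M |S. S \<in> sets N2'}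
      else {X3 -` S \<inter> space M |S. S \<in> sets N3}) {1::nat, 2, 3}"
    by (rule indep_sets_mono_sets[OF conjunct2[OF conjunct2[OF conjunct2[OF I[unfolded indep_three_def]]]]])
      (use sub in \<open>simp only: split: if_split, blast\<close>)
  show ?thesis
    unfolding indep_three_def using I measurable_compose[OF X2 f] *
    unfolding indep_three_def by blast
qed

text \<open>Tonelli on the product law. Nonnegative integrals allow an infinite factor, which is the
  case of interest for the risk.\<close>

lemma (in prob_space) indep_three_nn_integral_mult:
  fixes f :: "'c \<Rightarrow> ennreal" and g :: "'d \<Rightarrow> ennreal"
  assumes I: "indep_three N1 X1 N2 X2 N3 X3"
    and f[measurable]: "f \<in> borel_measurable N2" and g[measurable]: "g \<in> borel_measurable N3"
  shows "(\<integral>\<^sup>+\<omega>. f (X2 \<omega>) * g (X3 \<omega>) \<partial>M) = (\<integral>\<^sup>+\<omega>. f (X2 \<omega>) \<partial>M) * (\<integral>\<^sup>+\<omega>. g (X3 \<omega>) \<partial>M)"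
proof -
  have [measurable]: "random_variable N1 X1" "random_variable N2 X2" "random_variable N3 X3"
    using I by (auto simp: indep_three_def)
  let ?D1 = "distr M N1 X1" and ?D2 = "distr M N2 X2" and ?D3 = "distr M N3 X3"
  interpret D1: prob_space ?D1 by (rule prob_space_distr) simp
  interpret D2: prob_space ?D2 by (rule prob_space_distr) simp
  interpret D3: prob_space ?D3 by (rule prob_space_distr) simp
  interpret D23: pair_prob_space ?D2 ?D3 ..
  have "(\<integral>\<^sup>+\<omega>. f (X2 \<omega>) * g (X3 \<omega>) \<partial>M) =
      (\<integral>\<^sup>+z. f (fst (snd z)) * g (snd (snd z)) \<partial>(distr M (N1 \<Otimes>\<^sub>M (N2 \<Otimes>\<^sub>M N3)) (\<lambda>\<omega>. (X1 \<omega>, X2 \<omega>, X3 \<omega>))))"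
    by (subst nn_integral_distr) auto
  also have "\<dots> = (\<integral>\<^sup>+x. \<integral>\<^sup>+z. f (fst z) * g (snd z) \<partial>(?D2 \<Otimes>\<^sub>M ?D3) \<partial>?D1)"
    unfolding indep_three_distr[OF I]
    by (subst D23.nn_integral_fst[symmetric]) simp_all
  also have "\<dots> = (\<integral>\<^sup>+z. f (fst z) * g (snd z) \<partial>(?D2 \<Otimes>\<^sub>M ?D3))"
    by (simp add: D1.emeasure_space_1 del: space_distr)
  also have "\<dots> = (\<integral>\<^sup>+x. \<integral>\<^sup>+y. f x * g y \<partial>?D3 \<partial>?D2)"
    by (subst D3.nn_integral_fst[symmetric]) simp_all
  also have "\<dots> = (\<integral>\<^sup>+x. f x \<partial>?D2) * (\<integral>\<^sup>+y. g y \<partial>?D3)"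
    by (simp add: nn_integral_cmult nn_integral_multc)
  also have "\<dots> = (\<integral>\<^sup>+\<omega>. f (X2 \<omega>) \<partial>M) * (\<integral>\<^sup>+\<omega>. g (X3 \<omega>) \<partial>M)"
    by (simp add: nn_integral_distr)
  finally show ?thesis .
qed

section \<open>Sign changes of noise coordinates\<close>

definition flip_coord :: "'m \<Rightarrow> 'b::ab_group_add ^ 'm \<Rightarrow> 'b ^ 'm::finite" where
  "flip_coord l v = (\<chi> k. if k = l then - (v $ k) else v $ k)"

lemma borel_measurable_vec_nth [measurable]:
  "f \<in> borel_measurable M \<Longrightarrow> (\<lambda>x. f x $ i) \<in> borel_measurable M"
  for f :: "'a \<Rightarrow> 'b::real_normed_vector ^ 'm::finite"
  by (rule borel_measurable_continuous_on[OF _ ]) (intro continuous_intros)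

lemma borel_measurable_vec_lambda [measurable (raw)]:
  fixes f :: "'a \<Rightarrow> 'm::finite \<Rightarrow> 'b::euclidean_space"
  assumes [measurable]: "\<And>i. (\<lambda>x. f x i) \<in> borel_measurable M"
  shows "(\<lambda>x. \<chi> i. f x i) \<in> borel_measurable M"
proof (subst borel_measurable_euclidean_space, rule ballI)
  fix b :: "'b ^ 'm" assume "b \<in> Basis"
  then obtain i u where "b = axis i u" by (auto simp: Basis_vec_def)
  then show "(\<lambda>x. (\<chi> i. f x i) \<bullet> b) \<in> borel_measurable M"
    by (simp add: inner_axis)
qed

lemma measurable_flip_coord [measurable]:
  "(flip_coord l :: 'b::euclidean_space ^ 'm::finite \<Rightarrow> _) \<in> borel \<rightarrow>\<^sub>M borel"
  unfolding flip_coord_def by measurable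

lemma distr_lborel_flip_coord: "distr lborel borel (flip_coord l) = (lborel :: (real ^ 'm::finite) measure)"
proof -
  \<comment> \<open>The diagonal of the reflection; the product of its absolute values is the
    Jacobian factor 1.\<close>
  define c :: "real ^ 'm \<Rightarrow> real" where "c j = (if j = axis l 1 then - 1 else 1)" for j
  have c_nonzero: "c j \<noteq> 0" for j by (simp add: c_def)
  have T: "(\<lambda>x. 0 + (\<Sum>j\<in>Basis. (c j * (x \<bullet> j)) *\<^sub>R j)) = flip_coord l"
  proof (rule ext, rule euclidean_eqI)
    fix x b :: "real ^ 'm" assume b: "b \<in> Basis"
    then obtain i where i: "b = axis i 1" by (auto simp: Basis_vec_def)
    have "(0 + (\<Sum>j\<in>Basis. (c j * (x \<bullet> j)) *\<^sub>R j)) \<bullet> b = c b * (x \<bullet> b)"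
      using b by (simp add: inner_sum_left inner_Basis if_distrib cong: if_cong)
    also have "\<dots> = flip_coord l x \<bullet> b"
      by (simp add: i inner_axis flip_coord_def c_def axis_eq_axis)
    finally show "(0 + (\<Sum>j\<in>Basis. (c j * (x \<bullet> j)) *\<^sub>R j)) \<bullet> b = flip_coord l x \<bullet> b" .
  qed
  have "lborel = density (distr lborel borel (flip_coord l)) (\<lambda>_ :: real ^ 'm. (\<Prod>j\<in>(Basis :: (real ^ 'm) set). \<bar>c j\<bar>))"
    by (rule lborel_affine_euclidean[of c "0 :: real ^ 'm", unfolded T]) (rule c_nonzero)
  also have "(\<Prod>j\<in>(Basis :: (real ^ 'm) set). \<bar>c j\<bar>) = 1"
    by (intro prod.neutral) (simp add: c_def)
  finally show ?thesis by (simp add: density_1)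
qed

lemma isotropic_normal_density_flip: "isotropic_normal_density s (flip_coord l v) = isotropic_normal_density s v"
  by (auto simp: isotropic_normal_density_def flip_coord_def normal_density_def intro!: prod.cong)

text \<open>The reflection preserves both Lebesgue measure and the density, hence the law.\<close>

lemma distributed_flip_coord:
  fixes X :: "'a \<Rightarrow> real ^ 'm::finite"
  assumes D: "distributed M lborel X f" and f: "\<And>v. f (flip_coord l v) = f v"
  shows "distr M borel (\<lambda>\<omega>. flip_coord l (X \<omega>)) = distr M borel X"
proof -
  have [measurable]: "X \<in> borel_measurable M" "f \<in> borel_measurable borel"
    using D by (auto simp: distributed_def)
  have X: "distr M borel X = density lborel f"
    using D by (simp add: distributed_def cong: distr_cong)
  have "distr M borel (\<lambda>\<omega>. flip_coord l (X \<omega>)) = distr (density lborel f) borel (flip_coord l)"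
    unfolding X[symmetric] by (subst distr_distr) (auto simp: comp_def)
  also have "\<dots> = distr (density lborel (\<lambda>v. f (flip_coord l v))) borel (flip_coord l)"
    by (simp add: f)
  also have "\<dots> = density (distr lborel borel (flip_coord l)) f"
    by (rule density_distr[symmetric]) auto
  finally show ?thesis by (simp add: distr_lborel_flip_coord X)
qed

text \<open>Negating a complex coordinate negates its real and imaginary parts together. By
  independence the joint law of the two parts is the product of the marginals, each of which is
  invariant; \<open>comb\<close> reassembles the complex vector.\<close>

lemma (in prob_space) complex_flip_coord_distr:
  fixes e :: "'a \<Rightarrow> complex ^ 'm::finite"
  assumes R: "distributed M lborel (\<lambda>\<omega>. \<chi> l. Re (e \<omega> $ l)) f" and I: "distributed M lborel (\<lambda>\<omega>. \<chi> l. Im (e \<omega> $ l)) f"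
    and f: "\<And>v. f (flip_coord l v) = f v"
    and ind: "indep_var borel (\<lambda>\<omega>. \<chi> l. Re (e \<omega> $ l)) borel (\<lambda>\<omega>. \<chi> l. Im (e \<omega> $ l))"
    and e[measurable]: "e \<in> borel_measurable M"
  shows "distr M borel (\<lambda>\<omega>. flip_coord l (e \<omega>)) = distr M borel e"
proof -
  let ?re = "\<lambda>\<omega>. (\<chi> l. Re (e \<omega> $ l)) :: real ^ 'm" and ?im = "\<lambda>\<omega>. (\<chi> l. Im (e \<omega> $ l)) :: real ^ 'm"
  define comb where "comb = (\<lambda>(u, v). (\<chi> l. Complex (u $ l) (v $ l)) :: complex ^ 'm)"
  have comb[measurable]: "comb \<in> borel \<Otimes>\<^sub>M borel \<rightarrow>\<^sub>M borel"
    unfolding comb_def Complex_eq split_beta' by measurable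
  have [measurable]: "?re \<in> borel_measurable M" "?im \<in> borel_measurable M"
    using R I by (auto simp: distributed_def)
  have ind': "indep_var borel (\<lambda>\<omega>. flip_coord l (?re \<omega>)) borel (\<lambda>\<omega>. flip_coord l (?im \<omega>))"
    using indep_var_compose[OF ind measurable_flip_coord[of l] measurable_flip_coord[of l]] by (simp add: comp_def)
  have "distr M (borel \<Otimes>\<^sub>M borel) (\<lambda>\<omega>. (flip_coord l (?re \<omega>), flip_coord l (?im \<omega>)))
      = distr M borel (\<lambda>\<omega>. flip_coord l (?re \<omega>)) \<Otimes>\<^sub>M distr M borel (\<lambda>\<omega>. flip_coord l (?im \<omega>))"
    using ind' by (simp add: indep_var_distribution_eq)
  also have "\<dots> = distr M borel ?re \<Otimes>\<^sub>M distr M borel ?im"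
    by (simp only: distributed_flip_coord[OF R f] distributed_flip_coord[OF I f])
  also have "\<dots> = distr M (borel \<Otimes>\<^sub>M borel) (\<lambda>\<omega>. (?re \<omega>, ?im \<omega>))"
    using ind by (simp add: indep_var_distribution_eq)
  finally have "distr (distr M (borel \<Otimes>\<^sub>M borel) (\<lambda>\<omega>. (flip_coord l (?re \<omega>), flip_coord l (?im \<omega>)))) borel comb
     = distr (distr M (borel \<Otimes>\<^sub>M borel) (\<lambda>\<omega>. (?re \<omega>, ?im \<omega>))) borel comb" by simp
  moreover have "comb (flip_coord l (?re \<omega>), flip_coord l (?im \<omega>)) = flip_coord l (e \<omega>)" for \<omega>
    by (simp add: comb_def flip_coord_def vec_eq_iff complex_eq_iff)
  moreover have "comb (?re \<omega>, ?im \<omega>) = e \<omega>" for \<omega>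
    by (simp add: comb_def vec_eq_iff complex_eq_iff)
  ultimately show ?thesis
    by (simp add: distr_distr comp_def)
qed

text \<open>A vanishing moment would put the law of the real part on a coordinate hyperplane. That
  is Lebesgue null, so a law with a density would have total mass zero.\<close>

lemma (in prob_space) second_moment_nonzero:
  fixes e :: "'a \<Rightarrow> complex ^ 'm::finite"
  assumes R: "distributed M lborel (\<lambda>\<omega>. \<chi> l. Re (e \<omega> $ l)) f" and e[measurable]: "e \<in> borel_measurable M"
  shows "(\<integral>\<^sup>+\<omega>. ennreal ((norm (e \<omega> $ l))\<^sup>2) \<partial>M) \<noteq> 0"
proof
  assume "(\<integral>\<^sup>+\<omega>. ennreal ((norm (e \<omega> $ l))\<^sup>2) \<partial>M) = 0"
  then have "AE \<omega> in M. e \<omega> $ l = 0"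
    by (subst (asm) nn_integral_0_iff_AE) auto
  then have ae: "AE \<omega> in M. (\<chi> l. Re (e \<omega> $ l)) $ l = 0" by eventually_elim simp
  have [measurable]: "(\<lambda>\<omega>. (\<chi> l. Re (e \<omega> $ l)) :: real ^ 'm) \<in> borel_measurable M" "f \<in> borel_measurable borel"
    using R by (auto simp: distributed_def)
  have dens: "distr M lborel (\<lambda>\<omega>. (\<chi> l. Re (e \<omega> $ l)) :: real ^ 'm) = density lborel f"
    using R by (simp add: distributed_def)
  have "AE v in distr M lborel (\<lambda>\<omega>. (\<chi> l. Re (e \<omega> $ l)) :: real ^ 'm). v $ l = 0"
    using ae by (subst AE_distr_iff) auto
  then have "AE v in lborel. f v \<noteq> 0 \<longrightarrow> (v :: real ^ 'm) $ l = 0"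
    unfolding dens by (subst (asm) AE_density) (auto simp: zero_less_iff_neq_zero)
  moreover have "AE v in lborel. (v :: real ^ 'm) $ l \<noteq> 0"
  proof -
    have "negligible {v :: real ^ 'm. v \<bullet> axis l 1 = 0}"
      by (intro negligible_standard_hyperplane) (auto simp: axis_in_Basis_iff)
    then have "{v :: real ^ 'm. v $ l = 0} \<in> null_sets lebesgue"
      by (simp add: negligible_iff_null_sets inner_axis)
    then have "emeasure lborel {v :: real ^ 'm. v $ l = 0} = 0"
      by (auto simp: null_sets_def)
    then show ?thesis
      by (intro AE_I[where N = "{v. v $ l = 0}"]) auto
  qed
  ultimately have "AE v in lborel. f v = 0" by eventually_elim auto
  then have "density lborel f = density lborel (\<lambda>_. 0)"
    by (intro density_cong) auto
  then have "emeasure (distr M lborel (\<lambda>\<omega>. (\<chi> l. Re (e \<omega> $ l)) :: real ^ 'm)) UNIV = 0"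
    unfolding dens by (simp add: emeasure_density)
  then show False by (simp add: emeasure_distr emeasure_space_1)
qed

text \<open>Flipping the sign of one coordinate of the noise preserves its law, and the two resulting
  errors differ by \<open>2 * e l * column l P\<close>, whatever the signal is.\<close>

lemma (in prob_space) risk_ge:
  fixes x :: "'a \<Rightarrow> complex ^ 'n::finite" and e :: "'a \<Rightarrow> complex ^ 'm::finite" and s :: "'a \<Rightarrow> real ^ 'm"
    and A :: "real ^ 'm \<Rightarrow> complex ^ 'n ^ 'm" and P :: "real ^ 'm \<Rightarrow> complex ^ 'm ^ 'n"
  assumes I: "indep_three borel x borel e borel s"
    and flip: "distr M borel (\<lambda>\<omega>. flip_coord l (e \<omega>)) = distr M borel e"
    and A[measurable]: "\<And>i j. (\<lambda>\<tau>. A \<tau> $ i $ j) \<in> borel_measurable borel"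
    and P[measurable]: "\<And>i j. (\<lambda>\<tau>. P \<tau> $ i $ j) \<in> borel_measurable borel"
  shows "(\<integral>\<^sup>+\<omega>. ennreal ((norm (e \<omega> $ l))\<^sup>2) \<partial>M) * (\<integral>\<^sup>+\<omega>. ennreal ((norm (column l (P (s \<omega>))))\<^sup>2) \<partial>M)
    \<le> (\<integral>\<^sup>+\<omega>. ennreal ((norm (P (s \<omega>) *v (A (s \<omega>) *v x \<omega> + e \<omega>) - x \<omega>))\<^sup>2) \<partial>M)"
proof -
  have [measurable]: "x \<in> borel_measurable M" "e \<in> borel_measurable M" "s \<in> borel_measurable M"
    using I by (auto simp: indep_three_def)
  let ?B = "borel \<Otimes>\<^sub>M (borel \<Otimes>\<^sub>M borel) :: ((complex ^ 'n) \<times> (complex ^ 'm) \<times> (real ^ 'm)) measure"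
  define F where "F = (\<lambda>(x, e, \<tau>). P \<tau> *v (A \<tau> *v x + e) - x)"
  have F_alt: "F = (\<lambda>z. \<chi> i. (\<Sum>j\<in>UNIV. P (snd (snd z)) $ i $ j * ((\<Sum>k\<in>UNIV. A (snd (snd z)) $ j $ k * fst z $ k) + fst (snd z) $ j)) - fst z $ i)"
    by (auto simp: F_def vec_eq_iff matrix_vector_mult_def)
  have F[measurable]: "F \<in> borel_measurable ?B"
    unfolding F_alt by measurable
  let ?e' = "\<lambda>\<omega>. flip_coord l (e \<omega>)"
  let ?G = "\<lambda>z. ennreal ((norm (F z))\<^sup>2)"
  \<comment> \<open>Both triples are independent, so their laws are products of the same
    marginals.\<close>
  have "distr M ?B (\<lambda>\<omega>. (x \<omega>, ?e' \<omega>, s \<omega>)) = distr M ?B (\<lambda>\<omega>. (x \<omega>, e \<omega>, s \<omega>))"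
    by (simp only: indep_three_distr[OF I] indep_three_distr[OF indep_three_compose[OF I measurable_flip_coord]] flip)
  then have "(\<integral>\<^sup>+z. ?G z \<partial>distr M ?B (\<lambda>\<omega>. (x \<omega>, ?e' \<omega>, s \<omega>))) = (\<integral>\<^sup>+z. ?G z \<partial>distr M ?B (\<lambda>\<omega>. (x \<omega>, e \<omega>, s \<omega>)))"
    by simp
  then have eq: "(\<integral>\<^sup>+\<omega>. ?G (x \<omega>, ?e' \<omega>, s \<omega>) \<partial>M) = (\<integral>\<^sup>+\<omega>. ?G (x \<omega>, e \<omega>, s \<omega>) \<partial>M)"
    by (simp add: nn_integral_distr)
  have pt: "2 * ((norm (e \<omega> $ l))\<^sup>2 * (norm (column l (P (s \<omega>))))\<^sup>2)
      \<le> (norm (F (x \<omega>, e \<omega>, s \<omega>)))\<^sup>2 + (norm (F (x \<omega>, ?e' \<omega>, s \<omega>)))\<^sup>2" for \<omega>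
  proof -
    let ?u = "F (x \<omega>, e \<omega>, s \<omega>)" and ?v = "F (x \<omega>, ?e' \<omega>, s \<omega>)"
    \<comment> \<open>The terms with \<open>x\<close> cancel exactly, so \<open>P\<close> need not
      invert \<open>A\<close> here.\<close>
    have "?u - ?v = P (s \<omega>) *v (e \<omega> - ?e' \<omega>)"
      by (simp add: F_def matrix_vector_mult_diff_distrib matrix_vector_right_distrib)
    also have "e \<omega> - ?e' \<omega> = axis l (2 * e \<omega> $ l)"
      by (simp add: flip_coord_def axis_def vec_eq_iff)
    also have "P (s \<omega>) *v axis l (2 * e \<omega> $ l) = (2 * e \<omega> $ l) *s column l (P (s \<omega>))"
      by (simp add: matrix_vector_mult_def axis_def column_def vec_eq_iff if_distrib mult.commute cong: if_cong)
    finally have "norm (?u - ?v) = 2 * (norm (e \<omega> $ l) * norm (column l (P (s \<omega>))))"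
      by (simp add: norm_vector_smult norm_mult)
    then have "4 * ((norm (e \<omega> $ l))\<^sup>2 * (norm (column l (P (s \<omega>))))\<^sup>2) = (norm (?u - ?v))\<^sup>2"
      by (simp add: power_mult_distrib)
    also have "\<dots> \<le> (norm ?u + norm ?v)\<^sup>2"
      by (intro power_mono norm_triangle_ineq4) simp
    also have "\<dots> \<le> 2 * ((norm ?u)\<^sup>2 + (norm ?v)\<^sup>2)"
      using sum_squares_bound[of "norm ?u" "norm ?v"] by (simp add: power2_sum)
    finally show ?thesis by simp
  qed
  have mcol[measurable]: "(\<lambda>\<tau>. column l (P \<tau>)) \<in> borel_measurable borel"
    unfolding column_def by measurable
  have "2 * ((\<integral>\<^sup>+\<omega>. ennreal ((norm (e \<omega> $ l))\<^sup>2) \<partial>M) * (\<integral>\<^sup>+\<omega>. ennreal ((norm (column l (P (s \<omega>))))\<^sup>2) \<partial>M))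
      = 2 * (\<integral>\<^sup>+\<omega>. ennreal ((norm (e \<omega> $ l))\<^sup>2) * ennreal ((norm (column l (P (s \<omega>))))\<^sup>2) \<partial>M)"
    by (subst indep_three_nn_integral_mult[OF I, of "\<lambda>v. ennreal ((norm (v $ l))\<^sup>2)" "\<lambda>\<tau>. ennreal ((norm (column l (P \<tau>)))\<^sup>2)"]) auto
  also have "\<dots> = (\<integral>\<^sup>+\<omega>. 2 * (ennreal ((norm (e \<omega> $ l))\<^sup>2) * ennreal ((norm (column l (P (s \<omega>))))\<^sup>2)) \<partial>M)"
    by (rule nn_integral_cmult[symmetric]) measurable
  also have "\<dots> \<le> (\<integral>\<^sup>+\<omega>. ?G (x \<omega>, e \<omega>, s \<omega>) + ?G (x \<omega>, ?e' \<omega>, s \<omega>) \<partial>M)"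
  proof (rule nn_integral_mono)
    fix \<omega>
    show "2 * (ennreal ((norm (e \<omega> $ l))\<^sup>2) * ennreal ((norm (column l (P (s \<omega>))))\<^sup>2))
        \<le> ?G (x \<omega>, e \<omega>, s \<omega>) + ?G (x \<omega>, ?e' \<omega>, s \<omega>)"
      using ennreal_leI[OF pt[of \<omega>]] by (simp add: ennreal_mult ennreal_plus)
  qed
  also have "\<dots> = (\<integral>\<^sup>+\<omega>. ?G (x \<omega>, e \<omega>, s \<omega>) \<partial>M) + (\<integral>\<^sup>+\<omega>. ?G (x \<omega>, ?e' \<omega>, s \<omega>) \<partial>M)"
    by (rule nn_integral_add) measurable
  also have "\<dots> = 2 * (\<integral>\<^sup>+\<omega>. ?G (x \<omega>, e \<omega>, s \<omega>) \<partial>M)"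
    by (simp add: eq mult_2)
  finally show ?thesis
    by (simp add: F_def ennreal_mult_le_mult_iff)
qed

section \<open>Divergence of the expectations\<close>

lemma column_eq_mult_axis: "column l B = B *v axis l 1" for B :: "'a::semiring_1 ^ 'm::finite ^ 'n"
  by (simp add: column_def matrix_vector_mult_def axis_def vec_eq_iff if_distrib cong: if_cong)

lemma measurable_fourier_matrix:
  "(\<lambda>\<tau>. fourier_matrix \<kappa> (\<lambda>l. \<tau> $ l) $ i $ j) \<in> borel_measurable (borel :: (real ^ 'm::finite) measure)"
  unfolding fourier_matrix_def vec_lambda_beta
  by (intro borel_measurable_continuous_onI continuous_intros)

theorem theorem6:
  fixes M :: "'a measure"
    and q :: nat
    and \<epsilon> :: real
    and \<kappa> :: "'n::finite \<Rightarrow> int"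
    and t :: "'m::finite \<Rightarrow> 'a \<Rightarrow> real"
    and x xhat :: "'a \<Rightarrow> complex ^ 'n"
    and e y :: "'a \<Rightarrow> complex ^ 'm"
    and A :: "'a \<Rightarrow> complex ^ 'n ^ 'm"
  assumes "prob_space M"
    and "q \<ge> 1" and "CARD('m) \<ge> 2" and "CARD('m) < 2 * CARD('n)"
    and "\<epsilon> > 0"
    and frequencies: "bij_betw \<kappa> UNIV {- int q..int q}"
    and nodes_indep: "prob_space.indep_vars M (\<lambda>_. borel) t UNIV"
    and nodes_uniform: "\<And>l. distr M borel (t l) = uniform_measure lborel {0..<1}"
    and A_eq: "\<And>\<omega>. A \<omega> = fourier_matrix \<kappa> (\<lambda>l. t l \<omega>)"
    and x_second_moment:
      "prob_space.expectation M (\<lambda>\<omega>. (\<chi> j k. x \<omega> $ j * cnj (x \<omega> $ k)) :: complex ^ 'n ^ 'n) = mat 1"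
    and Re_noise: "distributed M lborel (\<lambda>\<omega>. (\<chi> l. Re (e \<omega> $ l)) :: real ^ 'm)
      (\<lambda>v. ennreal (isotropic_normal_density (\<epsilon> / sqrt (2 * real CARD('m))) v))"
    and Im_noise: "distributed M lborel (\<lambda>\<omega>. (\<chi> l. Im (e \<omega> $ l)) :: real ^ 'm)
      (\<lambda>v. ennreal (isotropic_normal_density (\<epsilon> / sqrt (2 * real CARD('m))) v))"
    and Re_Im_indep: "prob_space.indep_var M borel (\<lambda>\<omega>. (\<chi> l. Re (e \<omega> $ l)) :: real ^ 'm)
      borel (\<lambda>\<omega>. (\<chi> l. Im (e \<omega> $ l)) :: real ^ 'm)"
    and x_e_t_indep: "prob_space.indep_three M borel x borel e
      borel (\<lambda>\<omega>. (\<chi> l. t l \<omega>) :: real ^ 'm)"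
    and y_eq: "\<And>\<omega>. y \<omega> = A \<omega> *v x \<omega> + e \<omega>"
    and xhat_eq: "\<And>\<omega>. xhat \<omega> = moore_penrose_inverse (A \<omega>) *v y \<omega>"
  shows "(\<integral>\<^sup>+\<omega>. ennreal (1 / (smallest_nonzero_singular_value (A \<omega>))\<^sup>2) \<partial>M) = \<infinity> \<and>
         (\<integral>\<^sup>+\<omega>. ennreal ((norm (xhat \<omega> - x \<omega>))\<^sup>2) \<partial>M) = \<infinity>"
proof -
  interpret uniform_nodes M t
    using assms(1) nodes_indep nodes_uniform by (simp add: uniform_nodes_def uniform_nodes_axioms_def)
  interpret symmetric_frequencies \<kappa> q
    using frequencies by unfold_locales
  define s where "s = (\<lambda>\<omega>. (\<chi> l. t l \<omega>) :: real ^ 'm)"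
  define A' where "A' \<tau> = (fourier_matrix \<kappa> (\<lambda>l. \<tau> $ l) :: complex ^ 'n ^ 'm)" for \<tau> :: "real ^ 'm"
  define P where "P \<tau> = full_rank_pinv (A' \<tau>)" for \<tau>
  have A_s: "A \<omega> = A' (s \<omega>)" for \<omega> by (simp add: A_eq A'_def s_def)
  have A'_meas: "(\<lambda>\<tau>. A' \<tau> $ i $ j) \<in> borel_measurable borel" for i j
    unfolding A'_def by (rule measurable_fourier_matrix)
  have P_meas [measurable]: "(\<lambda>\<tau>. P \<tau> $ i $ j) \<in> borel_measurable borel" for i j
    unfolding P_def by (rule measurable_full_rank_pinv) (rule A'_meas)
  have [measurable]: "s \<in> borel_measurable M" "e \<in> borel_measurable M"
    using x_e_t_indep by (auto simp: indep_three_def s_def)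
  have col_meas [measurable]: "(\<lambda>\<omega>. column l (P (s \<omega>))) \<in> borel_measurable M" for l
  proof -
    have "(\<lambda>\<tau>. column l (P \<tau>)) \<in> borel_measurable borel"
      unfolding column_def by measurable
    then show ?thesis by (rule measurable_compose[rotated]) simp
  qed
  have pinv: "AE \<omega> in M. is_moore_penrose_inverse (A \<omega>) (P (s \<omega>))"
    using AE_nodes_distinct AE_nodes_in_interval
    by eventually_elim (simp add: A_eq P_def A'_def s_def full_rank_pinv_fourier(1))
  obtain a :: 'm and J C where J: "J \<noteq> {}" "a \<notin> J" and "C > 0"
    and C: "\<forall>(\<tau> :: 'm \<Rightarrow> real) D. inj \<tau> \<and> range \<tau> \<subseteq> {0..<1} \<and> 0 \<le> D \<and> D \<le> 1 \<and>
       (\<forall>j\<in>J. \<bar>\<tau> j - \<tau> a\<bar> \<le> D) \<longrightarrow>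
       1 \<le> C * D ^ card J * (\<Sum>l\<in>UNIV. (norm (column l (full_rank_pinv (fourier_matrix \<kappa> \<tau>))))\<^sup>2)"
    by (rule clustered_nodes_bound[OF assms(3,4)]) (rule that)
  let ?S = "\<lambda>\<omega>. \<Sum>l\<in>UNIV. (norm (column l (P (s \<omega>))))\<^sup>2"
  \<comment> \<open>Nodes in a cluster are within \<open>3 * 4 ^ - n\<close> of node
    \<open>a\<close>; the power of 3 is moved into the constant.\<close>
  define c where "c = C * 3 ^ card J"
  have "c > 0" using \<open>C > 0\<close> by (simp add: c_def)
  have "(\<integral>\<^sup>+\<omega>. ennreal (c * ?S \<omega>) \<partial>M) = \<infinity>"
  proof (rule nn_integral_cluster_infinite[OF J(2,1)], use AE_nodes_distinct AE_nodes_in_interval in eventually_elim, intro allI impI)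
    fix \<omega> n assume w: "inj (\<lambda>l. t l \<omega>)" "range (\<lambda>l. t l \<omega>) \<subseteq> {0..<1}" and n: "1 \<le> n" "\<omega> \<in> cluster a J n"
    let ?h = "(1 / 4) ^ n :: real"
    \<comment> \<open>Ensures that the diameter \<open>3 * ?h\<close> is at most 1.\<close>
    have "?h \<le> (1 / 4) ^ 1" using n by (intro power_decreasing) auto
    moreover have "\<forall>j\<in>J. \<bar>t j \<omega> - t a \<omega>\<bar> \<le> 3 * ?h"
    proof
      fix j assume "j \<in> J"
      note d = cluster_distance[OF n(2) this J(2)]
      moreover have "0 < ?h" by simp
      ultimately show "\<bar>t j \<omega> - t a \<omega>\<bar> \<le> 3 * ?h" by linarith
    qed
    ultimately have "1 \<le> C * (3 * ?h) ^ card J * ?S \<omega>"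
      using C[rule_format, of "\<lambda>l. t l \<omega>" "3 * ?h"] w by (simp add: P_def A'_def s_def)
    then have "4 ^ (n * card J) * 1 \<le> 4 ^ (n * card J) * (C * (3 * ?h) ^ card J * ?S \<omega>)"
      by (intro mult_left_mono) auto
    also have "\<dots> = (4 ^ n * ?h) ^ card J * (c * ?S \<omega>)"
      by (simp add: c_def power_mult power_mult_distrib)
    also have "4 ^ n * ?h = 1" by (simp add: power_one_over)
    finally show "ennreal (4 ^ (n * card J)) \<le> ennreal (c * ?S \<omega>)"
      by (intro ennreal_leI) simp
  qed
  moreover have "(\<integral>\<^sup>+\<omega>. ennreal (c * ?S \<omega>) \<partial>M) =
      ennreal c * (\<Sum>l\<in>UNIV. \<integral>\<^sup>+\<omega>. ennreal ((norm (column l (P (s \<omega>))))\<^sup>2) \<partial>M)"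
  proof -
    have "(\<integral>\<^sup>+\<omega>. ennreal (c * ?S \<omega>) \<partial>M) = (\<integral>\<^sup>+\<omega>. ennreal c * (\<Sum>l\<in>UNIV. ennreal ((norm (column l (P (s \<omega>))))\<^sup>2)) \<partial>M)"
      using \<open>c > 0\<close> by (simp add: ennreal_mult sum_nonneg)
    also have "\<dots> = ennreal c * (\<integral>\<^sup>+\<omega>. (\<Sum>l\<in>UNIV. ennreal ((norm (column l (P (s \<omega>))))\<^sup>2)) \<partial>M)"
      by (rule nn_integral_cmult) measurable
    also have "\<dots> = ennreal c * (\<Sum>l\<in>UNIV. \<integral>\<^sup>+\<omega>. ennreal ((norm (column l (P (s \<omega>))))\<^sup>2) \<partial>M)"
      by (subst nn_integral_sum) auto
    finally show ?thesis .
  qed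
  \<comment> \<open>A finite sum is infinite only if some summand is, so one fixed column carries
    the divergence.\<close>
  ultimately obtain l where l: "(\<integral>\<^sup>+\<omega>. ennreal ((norm (column l (P (s \<omega>))))\<^sup>2) \<partial>M) = \<infinity>"
    by (auto simp: ennreal_mult_eq_top_iff)
  have "(\<integral>\<^sup>+\<omega>. ennreal ((norm (column l (P (s \<omega>))))\<^sup>2) \<partial>M)
      \<le> (\<integral>\<^sup>+\<omega>. ennreal (1 / (smallest_nonzero_singular_value (A \<omega>))\<^sup>2) \<partial>M)"
  \<comment> \<open>Monotonicity of the nonnegative integral holds for arbitrary functions, so
    measurability of the singular value does not arise.\<close>
  proof (rule nn_integral_mono_AE, use pinv in eventually_elim)
    case (elim \<omega>)
    have "A \<omega> \<noteq> 0" by (simp add: A_eq fourier_matrix_nonzero)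
    from smallest_nonzero_singular_value_bound[OF elim this, of "axis l 1"] show ?case
      by (intro ennreal_leI) (simp add: column_eq_mult_axis)
  qed
  moreover have "(\<integral>\<^sup>+\<omega>. ennreal ((norm (xhat \<omega> - x \<omega>))\<^sup>2) \<partial>M) = \<infinity>"
  proof -
    have "distr M borel (\<lambda>\<omega>. flip_coord l (e \<omega>)) = distr M borel e"
      by (rule complex_flip_coord_distr[OF Re_noise Im_noise _ Re_Im_indep]) (simp_all add: isotropic_normal_density_flip)
    from risk_ge[OF x_e_t_indep[folded s_def] this A'_meas P_meas]
    have "(\<integral>\<^sup>+\<omega>. ennreal ((norm (e \<omega> $ l))\<^sup>2) \<partial>M) * (\<integral>\<^sup>+\<omega>. ennreal ((norm (column l (P (s \<omega>))))\<^sup>2) \<partial>M)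
      \<le> (\<integral>\<^sup>+\<omega>. ennreal ((norm (P (s \<omega>) *v (A' (s \<omega>) *v x \<omega> + e \<omega>) - x \<omega>))\<^sup>2) \<partial>M)" .
    also have "\<dots> = (\<integral>\<^sup>+\<omega>. ennreal ((norm (xhat \<omega> - x \<omega>))\<^sup>2) \<partial>M)"
      by (rule nn_integral_cong_AE, use pinv in eventually_elim)
        (simp add: xhat_eq y_eq A_s moore_penrose_inverse_eqI)
    \<comment> \<open>The infinite column moment is multiplied by a noise moment that is not zero,
      so the product is infinite.\<close>
    finally show ?thesis
      using second_moment_nonzero[OF Re_noise, of l] by (simp add: l ennreal_mult_top top.extremum_unique)
  qed
  ultimately show ?thesis by (simp add: l top.extremum_unique)
qed

end
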